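(* Let $0<\mu\le L$, $\sigma\ge 0$, and let $f:\mathbb{R}^d\to\mathbb{R}$ be a continuously differentiable function. Let $(\theta_k)_{k\in\mathbb{N}_0}$ be a stochastic gradient descent scheme for $f$ with step-size $\gamma$ and noise $(D_k)_{k\in\mathbb{N}}$ (as defined in the context), where $$0<\gamma<\frac{2}{L+\frac{\sigma}{2}},$$ and let $\theta^\ast\in\mathbb{R}^d$ be a $(\mu,L,\sigma)$-regular point. Set $$m(\gamma):=\max\left((1-\gamma\mu)^2+\frac{\gamma^2\sigma\mu}{2},\ (1-\gamma L)^2+\frac{\gamma^2\sigma L}{2}\right).$$ Then for every $\delta>0$ there exists an open neighborhood $V$ of $\theta^\ast$ such that, for the event $\mathbb{V}:=\bigcup_{k\in\mathbb{N}_0}\{\theta_k\in V\}$, the following holds: there exists an event $\mathbb{C}$ with $\mathbb{P}(\mathbb{C}\cap\mathbb{V})\ge(1-\delta)\,\mathbb{P}(\mathbb{V})$ such that, on $\mathbb{C}\cap\mathbb{V}$, the scheme $(\theta_k)_{k\in\mathbb{N}_0}$ almost surely converges to a (random) local minimum $\theta_\infty$ of $f$ with $f(\theta_\infty)=f(\theta^\ast)$, and for every $\varepsilon>0$ one has almost surely (on $\mathbb{C}\cap\mathbb{V}$) that $$\limsup_{k\to\infty}\,(m(\gamma)+\varepsilon)^{-k}\,\|\theta_k-\theta_\infty\|^2=0$$ and $$\limsup_{k\to\infty}\,(m(\gamma)+\varepsilon)^{-k}\,\big(f(\theta_k)-f(\theta_\infty)\big)=0.$$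
   Context: Stochastic gradient descent (SGD) scheme: let $f:\mathbb{R}^d\to\mathbb{R}$ be continuously differentiable and let $(\mathcal{F}_k)_{k\in\mathbb{N}_0}$ be a filtration on a probability space. An adapted stochastic process $(\theta_k)_{k\in\mathbb{N}_0}$ with values in $\mathbb{R}^d$ is called an SGD scheme if for all $k\in\mathbb{N}$ $$\theta_k=\theta_{k-1}-\gamma\big(\nabla f(\theta_{k-1})+D_k\big),$$ where $\gamma>0$ is the step-size and $(D_k)_{k\in\mathbb{N}}$ is an adapted integrable $\mathbb{R}^d$-valued process with $\mathbb{E}[D_k\mid\mathcal{F}_{k-1}]=0$ for all $k\in\mathbb{N}$. Regular points: let $0<\mu\le L$ and $\sigma\ge0$. A local minimum $\theta^\ast\in\mathbb{R}^d$ of $f$ is called a $(\mu,L)$-regular point if there exists an open neighborhood $U\subset\mathbb{R}^d$ of $\theta^\ast$ such that (A1) $f|_U$ is twice continuously differentiable and $f(\theta)\ge f(\theta^\ast)$ for all $\theta\in U$; (A2) $\|\nabla f(\theta)\|^2\ge2\mu\,(f(\theta)-f(\theta^\ast))$ for all $\theta\in U$ (Polyak–Łojasiewicz inequality); (A3) $\|\nabla f(\theta)-\nabla f(\theta')\|\le L\|\theta-\theta'\|$ for all $\theta,\theta'\in U$. It is called a $(\mu,L,\sigma)$-regular point (relative to the given SGD scheme) if $U$ can be chosen so that additionally (A4) for all $k\in\mathbb{N}$, almost surely on the event $\{\theta_{k-1}\in U\}$, $\mathbb{E}[D_k\mid\mathcal{F}_{k-1}]=0$ and $\mathbb{E}[\|D_k\|^2\mid\mathcal{F}_{k-1}]\le\sigma\,(f(\theta_{k-1})-f(\theta^\ast))$.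 Here $\|\cdot\|$ is the Euclidean norm. *)

theory Defs
  imports "HOL-Probability.Probability"
begin

definition gradient :: "('v::euclidean_space \<Rightarrow> real) \<Rightarrow> 'v \<Rightarrow> 'v" where
  "gradient f x = (THE D. GDERIV f x :> D)"

lemma gradient_eqI:
  assumes "GDERIV f x :> D"
  shows "gradient f x = D"
  unfolding gradient_def
proof (rule the_equality)
  fix D' assume "GDERIV f x :> D'"
  then have "(\<lambda>h. inner h D') = (\<lambda>h. inner h D)"
    using assms unfolding gderiv_def by (rule has_derivative_unique)
  then show "D' = D"
    by (metis inner_commute vector_eq_rdot)
qed (rule assms)

lemma GDERIV_gradient:
  fixes f :: "'v::euclidean_space \<Rightarrow> real"
  assumes "f differentiable (at x)"
  shows "GDERIV f x :> gradient f x"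
proof -
  obtain f' where f': "(f has_derivative f') (at x)"
    using assms by (auto simp: differentiable_def)
  then have "linear f'" by (rule has_derivative_linear)
  then have "f' = (\<lambda>h. inner h (adjoint f' 1))"
    by (auto simp: adjoint_works)
  with f' have "GDERIV f x :> adjoint f' 1"
    by (simp add: gderiv_def)
  with gradient_eqI[OF this] show ?thesis by simp
qed

definition continuously_differentiable_on ::
    "'v::euclidean_space set \<Rightarrow> ('v \<Rightarrow> real) \<Rightarrow> bool" where
  "continuously_differentiable_on U f \<longleftrightarrow>
     (\<forall>x\<in>U. f differentiable (at x)) \<and> continuous_on U (gradient f)"

text \<open>
  Only used for open \<open>U\<close>. The map \<open>H\<close> is the Hessian, viewed as a map into the bounded
  linear operators with the operator norm.
\<close>

definition twice_continuously_differentiable_on ::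
    "'v::euclidean_space set \<Rightarrow> ('v \<Rightarrow> real) \<Rightarrow> bool" where
  "twice_continuously_differentiable_on U f \<longleftrightarrow>
     continuously_differentiable_on U f \<and>
     (\<exists>H :: 'v \<Rightarrow> 'v \<Rightarrow>\<^sub>L 'v.
        (\<forall>x\<in>U. (gradient f has_derivative blinfun_apply (H x)) (at x)) \<and> continuous_on U H)"

definition local_minimum :: "('v::euclidean_space \<Rightarrow> real) \<Rightarrow> 'v \<Rightarrow> bool" where
  "local_minimum f x \<longleftrightarrow> (\<exists>U. open U \<and> x \<in> U \<and> (\<forall>y\<in>U. f x \<le> f y))"

text \<open>
  The library has conditional expectations of real-valued functions only; for an integrable
  vector-valued function the conditional expectation is taken coordinatewise.
\<close>

definition vec_cond_exp ::
    "'\<omega> measure \<Rightarrow> '\<omega> measure \<Rightarrow> ('\<omega> \<Rightarrow> 'v::euclidean_space) \<Rightarrow> '\<omega> \<Rightarrow> 'v" where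
  "vec_cond_exp M G X \<omega> = (\<Sum>b\<in>Basis. real_cond_exp M G (\<lambda>\<omega>. X \<omega> \<bullet> b) \<omega> *\<^sub>R b)"

text \<open>
  The noise is indexed by \<open>k \<ge> 1\<close>, so \<open>D 0\<close> is unconstrained. As usual for
  random variables, the recursion is an almost sure equality.
\<close>

definition sgd_scheme ::
    "'\<omega> measure \<Rightarrow> (nat \<Rightarrow> '\<omega> measure) \<Rightarrow> ('v::euclidean_space \<Rightarrow> real) \<Rightarrow> real \<Rightarrow>
     (nat \<Rightarrow> '\<omega> \<Rightarrow> 'v) \<Rightarrow> (nat \<Rightarrow> '\<omega> \<Rightarrow> 'v) \<Rightarrow> bool" where
  "sgd_scheme M F f \<gamma> \<theta> D \<longleftrightarrow>
     0 < \<gamma> \<and>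
     (\<forall>k. \<theta> k \<in> borel_measurable (F k)) \<and>
     (\<forall>k\<ge>1. D k \<in> borel_measurable (F k) \<and> integrable M (D k) \<and>
        (AE \<omega> in M. vec_cond_exp M (F (k - 1)) (D k) \<omega> = 0) \<and>
        (AE \<omega> in M. \<theta> k \<omega> = \<theta> (k - 1) \<omega> - \<gamma> *\<^sub>R (gradient f (\<theta> (k - 1) \<omega>) + D k \<omega>)))"

text \<open>
  Square integrability of \<open>D k\<close> is not assumed, so the conditional second moment is the
  extended nonnegative one.
\<close>

definition regular_point ::
    "'\<omega> measure \<Rightarrow> (nat \<Rightarrow> '\<omega> measure) \<Rightarrow> ('v::euclidean_space \<Rightarrow> real) \<Rightarrow>
     (nat \<Rightarrow> '\<omega> \<Rightarrow> 'v) \<Rightarrow> (nat \<Rightarrow> '\<omega> \<Rightarrow> 'v) \<Rightarrow> real \<Rightarrow> real \<Rightarrow> real \<Rightarrow> 'v \<Rightarrow> bool" where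
  "regular_point M F f \<theta> D \<mu> L \<sigma> \<theta>star \<longleftrightarrow>
     local_minimum f \<theta>star \<and>
     (\<exists>U. open U \<and> \<theta>star \<in> U \<and>
        twice_continuously_differentiable_on U f \<and>
        (\<forall>x\<in>U. f x \<ge> f \<theta>star) \<and>
        (\<forall>x\<in>U. (norm (gradient f x))\<^sup>2 \<ge> 2 * \<mu> * (f x - f \<theta>star)) \<and>
        (\<forall>x\<in>U. \<forall>y\<in>U. norm (gradient f x - gradient f y) \<le> L * norm (x - y)) \<and>
        (\<forall>k\<ge>1. AE \<omega> in M. \<theta> (k - 1) \<omega> \<in> U \<longrightarrow>
           vec_cond_exp M (F (k - 1)) (D k) \<omega> = 0 \<and>
           nn_cond_exp M (F (k - 1)) (\<lambda>\<omega>. ennreal ((norm (D k \<omega>))\<^sup>2)) \<omega>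
             \<le> ennreal (\<sigma> * (f (\<theta> (k - 1) \<omega>) - f \<theta>star))))"

definition rate :: "real \<Rightarrow> real \<Rightarrow> real \<Rightarrow> real \<Rightarrow> real" where
  "rate \<mu> L \<sigma> \<gamma> =
     max ((1 - \<gamma> * \<mu>)\<^sup>2 + \<gamma>\<^sup>2 * \<sigma> * \<mu> / 2) ((1 - \<gamma> * L)\<^sup>2 + \<gamma>\<^sup>2 * \<sigma> * L / 2)"

end

theory Submission
  imports Defs
begin

text \<open>
  The Lyapunov function is the squared distance of \<open>\<theta> k\<close> to the set of minima near \<open>\<theta>star\<close>, not
  \<open>f\<close> itself. If \<open>p\<close> is a minimum nearest to \<open>\<theta> k\<close>, then the squared distance of \<open>\<theta> (k + 1)\<close> is at
  most \<open>(norm (\<theta> (k + 1) - p))\<^sup>2\<close>, and averaging the noise leaves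
  \<open>(norm (x - \<gamma> *\<^sub>R \<nabla>f x - p))\<^sup>2 + \<gamma>\<^sup>2 \<sigma> (f x - f \<theta>star)\<close> at \<open>x = \<theta> k\<close>. Linearising at \<open>p\<close>, an
  eigendirection of the Hessian with eigenvalue \<open>\<lambda>\<close> contributes the factor
  \<open>(1 - \<gamma> \<lambda>)\<^sup>2 + \<gamma>\<^sup>2 \<sigma> \<lambda> / 2\<close>, which is convex in \<open>\<lambda>\<close>, so that its maximum over \<open>[\<mu>, L]\<close> is the rate;
  the kernel of the Hessian does not contribute because \<open>x - p\<close> is nearly orthogonal to it.
  While a path stays near \<open>\<theta>star\<close>, its expected squared distances and increments therefore decay
  geometrically. Chebyshev's inequality shows that a path started very close to \<open>\<theta>star\<close> leaves only
  with small probability, and the summability of the increments gives the limit and the rate.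
\<close>

section \<open>Quadratic forms and the rate\<close>

text \<open>The minima near \<open>\<theta>star\<close> may form a continuum: the Hessian may have a
  kernel, no single point attracts the scheme, and the limit is random. No smooth structure of the
  set of minima and no smooth projection onto it is used; a nearest minimum serves only as a
  competitor, and quadratic growth, a consequence of the Polyak-Lojasiewicz inequality, replaces the
  tangent space.

  The second moment of the noise is controlled only while the iterate lies in \<open>U\<close>;
  elsewhere \<open>D k\<close> is merely integrable. All estimates are therefore integrals over
  events known at time \<open>k\<close> on which the path has not yet left.

  The required probability is relative to that of ever entering \<open>V\<close>, which may be tiny.
  So the exit estimate is proportional to the probability of the starting event and is summed over
  the times of first entry.

  The bound on \<open>\<gamma>\<close> is exactly what puts the rate below 1. The excess
  \<open>\<epsilon>\<close> over the rate pays for the linearisation error, the kernel component and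
  the passage from expectations to single paths.\<close>

lemma symmetric_form_diff:
  fixes A :: "'v::real_inner \<Rightarrow> 'v"
  assumes lin: "linear A" and sym: "\<And>x y. A x \<bullet> y = x \<bullet> A y"
  shows "A (x - t *\<^sub>R y) \<bullet> (x - t *\<^sub>R y) = A x \<bullet> x - 2 * t * (A x \<bullet> y) + t\<^sup>2 * (A y \<bullet> y)"
proof -
  interpret linear A by (rule lin)
  have "A y \<bullet> x = A x \<bullet> y" using sym[of x y] by (simp add: inner_commute)
  then show ?thesis
    by (simp add: diff scaleR inner_diff power2_eq_square algebra_simps)
qed

lemma norm_diff_scaleR_square:
  fixes x y :: "'v::real_inner"
  shows "(norm (x - t *\<^sub>R y))\<^sup>2 = (norm x)\<^sup>2 - 2 * t * (x \<bullet> y) + t\<^sup>2 * (norm y)\<^sup>2"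
  using symmetric_form_diff[OF linear_ident, of x t y] by (simp add: power2_norm_eq_inner)

text \<open>For an eigenvalue \<open>\<lambda>\<close> of \<open>A\<close>, \<open>pl\<close> reads
  \<open>\<mu> * \<lambda> \<le> \<lambda>\<^sup>2\<close>, so every nonzero eigenvalue is at least
  \<open>\<mu>\<close>, and on the range of \<open>A\<close> only these count. A single test vector
  for positivity replaces the eigenvectors.\<close>

lemma psd_form_lower_bound:
  fixes A :: "'v::real_inner \<Rightarrow> 'v"
  assumes lin: "linear A"
    and sym: "\<And>x y. A x \<bullet> y = x \<bullet> A y"
    and psd: "\<And>x. 0 \<le> A x \<bullet> x"
    and pl: "\<And>x. \<mu> * (A x \<bullet> x) \<le> (norm (A x))\<^sup>2"
    and \<mu>: "0 < \<mu>"
  shows "\<mu> * (norm (A z))\<^sup>2 \<le> A (A z) \<bullet> A z"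
proof -
  interpret linear A by (rule lin)
  let ?w = "A z"
  \<comment> \<open>The multiple \<open>1 / \<mu>\<close> minimises this quadratic in the extreme
    case that \<open>A z\<close> is an eigenvector with eigenvalue \<open>\<mu>\<close>.\<close>
  have "0 \<le> A (z - (1 / \<mu>) *\<^sub>R ?w) \<bullet> (z - (1 / \<mu>) *\<^sub>R ?w)"
    by (rule psd)
  also have "\<dots> = A z \<bullet> z - 2 * (?w \<bullet> ?w) / \<mu> + (A ?w \<bullet> ?w) / \<mu>\<^sup>2"
    by (simp add: symmetric_form_diff[OF lin sym] power2_eq_square)
  finally have 1: "0 \<le> A z \<bullet> z - 2 * (?w \<bullet> ?w) / \<mu> + (A ?w \<bullet> ?w) / \<mu>\<^sup>2" .
  have "A z \<bullet> z \<le> (?w \<bullet> ?w) / \<mu>"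
    using pl[of z] \<mu> by (simp add: field_simps power2_norm_eq_inner)
  with 1 have "(?w \<bullet> ?w) / \<mu> \<le> (A ?w \<bullet> ?w) / \<mu>\<^sup>2"
    by (simp add: field_simps)
  then show ?thesis
    using \<mu> unfolding power2_norm_eq_inner by (simp add: field_simps power2_eq_square)
qed

text \<open>The discriminant condition \<open>b\<^sup>2 \<le> a * c * b\<close> with one factor
  \<open>b\<close> cancelled; it is used below as Cauchy-Schwarz for a semidefinite form.\<close>

lemma quadratic_nonneg_imp:
  fixes a b c :: real
  assumes "\<And>t. 0 \<le> a - 2 * t * b + t\<^sup>2 * (c * b)" and "0 \<le> b" "0 \<le> c"
  shows "b \<le> c * a"
proof (cases "c = 0")
  case True
  then have "b = 0"
    using assms(1)[of "(a + 1) / (2 * b)"] by (cases "b = 0") auto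
  with True show ?thesis by simp
next
  case False
  then show ?thesis
    using assms(1)[of "1 / c"] assms(3)
    by (simp add: power2_eq_square field_simps)
qed

text \<open>
  On the range of \<open>A\<close> this says that \<open>(A - \<mu>) (L - A)\<close> is positive semidefinite; it replaces the
  spectral theorem.
\<close>

lemma psd_form_interpolation:
  fixes A :: "'v::real_inner \<Rightarrow> 'v"
  assumes lin: "linear A"
    and sym: "\<And>x y. A x \<bullet> y = x \<bullet> A y"
    and psd: "\<And>x. 0 \<le> A x \<bullet> x"
    and pl: "\<And>x. \<mu> * (A x \<bullet> x) \<le> (norm (A x))\<^sup>2"
    and lip: "\<And>x. norm (A x) \<le> L * norm x"
    and \<mu>: "0 < \<mu>" "\<mu> \<le> L"
  shows "(norm (A (A z)))\<^sup>2 + \<mu> * L * (norm (A z))\<^sup>2 \<le> (\<mu> + L) * (A (A z) \<bullet> A z)"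
proof -
  interpret linear A by (rule lin)
  let ?w = "A z"
  define q where "q = A ?w - \<mu> *\<^sub>R ?w"
  have lower: "\<mu> * (A y \<bullet> A y) \<le> A (A y) \<bullet> A y" for y
    using psd_form_lower_bound[OF lin sym psd pl \<mu>(1)] by (simp add: power2_norm_eq_inner)
  have q: "q = A (?w - \<mu> *\<^sub>R z)"
    by (simp add: q_def diff scaleR)
  \<comment> \<open>Cauchy-Schwarz for the form of \<open>A - \<mu>\<close>, which by
    \<open>lower\<close> is semidefinite on the range of \<open>A\<close>: the quadratic in
    \<open>t\<close> bounds its value at \<open>?w - t *\<^sub>R q\<close> from above. The vector
    \<open>q\<close> lies in the range too, so all test vectors are admissible.\<close>
  have "q \<bullet> q \<le> (L - \<mu>) * (q \<bullet> ?w)"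
  proof (rule quadratic_nonneg_imp)
    fix t
    have *: "?w - t *\<^sub>R q = A (z - t *\<^sub>R (?w - \<mu> *\<^sub>R z))"
      unfolding q by (simp only: diff scaleR)
    have "A q \<bullet> q \<le> norm (A q) * norm q"
      by (rule norm_cauchy_schwarz)
    also have "\<dots> \<le> L * norm q * norm q"
      by (intro mult_right_mono lip) auto
    finally have Aq: "A q \<bullet> q \<le> L * (q \<bullet> q)"
      by (simp add: power2_eq_square flip: power2_norm_eq_inner)
    have "0 \<le> A (?w - t *\<^sub>R q) \<bullet> (?w - t *\<^sub>R q) - \<mu> * ((?w - t *\<^sub>R q) \<bullet> (?w - t *\<^sub>R q))"
      using lower[of "z - t *\<^sub>R (?w - \<mu> *\<^sub>R z)"] unfolding *[symmetric] by simp
    also have "\<dots> = (A ?w - \<mu> *\<^sub>R ?w) \<bullet> ?w - 2 * t * ((A ?w - \<mu> *\<^sub>R ?w) \<bullet> q)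
        + t\<^sup>2 * (A q \<bullet> q - \<mu> * (q \<bullet> q))"
      unfolding symmetric_form_diff[OF lin sym]
        symmetric_form_diff[OF linear_ident refl, of ?w t q]
      by (simp add: inner_diff_left algebra_simps)
    also have "\<dots> \<le> q \<bullet> ?w - 2 * t * (q \<bullet> q) + t\<^sup>2 * ((L - \<mu>) * (q \<bullet> q))"
      unfolding q_def[symmetric] left_diff_distrib
      using Aq by (intro add_left_mono mult_left_mono diff_right_mono) auto
    finally show "0 \<le> q \<bullet> ?w - 2 * t * (q \<bullet> q) + t\<^sup>2 * ((L - \<mu>) * (q \<bullet> q))" .
  qed (use \<mu> in auto)
  moreover have "q \<bullet> q = (norm (A ?w))\<^sup>2 - 2 * \<mu> * (A ?w \<bullet> ?w) + \<mu>\<^sup>2 * (norm ?w)\<^sup>2"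
    unfolding q_def power2_norm_eq_inner[symmetric] by (rule norm_diff_scaleR_square)
  moreover have "q \<bullet> ?w = A ?w \<bullet> ?w - \<mu> * (norm ?w)\<^sup>2"
    by (simp add: q_def inner_diff_left power2_norm_eq_inner)
  ultimately show ?thesis
    by (simp add: power2_eq_square algebra_simps)
qed

text \<open>The interpolation inequality eliminates \<open>(norm (A w))\<^sup>2\<close>, and what
  remains is affine in \<open>a\<close> for fixed \<open>n\<close>. As \<open>a\<close> ranges over
  \<open>[\<mu> * n, L * n]\<close>, the sign of the slope \<open>c\<close> selects the endpoint,
  and the two endpoints give the two terms of the maximum in \<open>rate\<close>.\<close>

lemma gradient_step_contraction_linear:
  fixes A :: "'v::real_inner \<Rightarrow> 'v"
  assumes lin: "linear A"
    and sym: "\<And>x y. A x \<bullet> y = x \<bullet> A y"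
    and psd: "\<And>x. 0 \<le> A x \<bullet> x"
    and pl: "\<And>x. \<mu> * (A x \<bullet> x) \<le> (norm (A x))\<^sup>2"
    and lip: "\<And>x. norm (A x) \<le> L * norm x"
    and \<mu>: "0 < \<mu>" "\<mu> \<le> L"
    and w: "w \<in> range A"
  shows "(norm (w - \<gamma> *\<^sub>R A w))\<^sup>2 + \<gamma>\<^sup>2 * \<sigma> / 2 * (A w \<bullet> w) \<le> rate \<mu> L \<sigma> \<gamma> * (norm w)\<^sup>2"
proof -
  obtain z where z: "w = A z" using w by auto
  define a n c where "a = A w \<bullet> w" and "n = w \<bullet> w"
    and "c = - 2 * \<gamma> + \<gamma>\<^sup>2 * (\<mu> + L) + \<gamma>\<^sup>2 * \<sigma> / 2"
  have low: "\<mu> * n \<le> a"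
    using psd_form_lower_bound[OF lin sym psd pl \<mu>(1), of z]
    by (simp add: z a_def n_def power2_norm_eq_inner)
  have "A w \<bullet> w \<le> norm (A w) * norm w"
    by (rule norm_cauchy_schwarz)
  also have "\<dots> \<le> L * norm w * norm w"
    by (intro mult_right_mono lip) auto
  finally have up: "a \<le> L * n"
    by (simp add: a_def n_def power2_eq_square flip: power2_norm_eq_inner)
  have int: "(norm (A w))\<^sup>2 \<le> (\<mu> + L) * a - \<mu> * L * n"
    using psd_form_interpolation[OF lin sym psd pl lip \<mu>, of z]
    by (simp add: z a_def n_def power2_norm_eq_inner)
  have n: "0 \<le> n" by (simp add: n_def)
  have "(norm (w - \<gamma> *\<^sub>R A w))\<^sup>2 + \<gamma>\<^sup>2 * \<sigma> / 2 * (A w \<bullet> w)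
      = n - 2 * \<gamma> * a + \<gamma>\<^sup>2 * (norm (A w))\<^sup>2 + \<gamma>\<^sup>2 * \<sigma> / 2 * a"
    unfolding norm_diff_scaleR_square
    by (simp add: a_def n_def inner_commute[of w "A w"] power2_norm_eq_inner)
  also have "\<dots> \<le> n - 2 * \<gamma> * a + \<gamma>\<^sup>2 * ((\<mu> + L) * a - \<mu> * L * n) + \<gamma>\<^sup>2 * \<sigma> / 2 * a"
    using mult_left_mono[OF int, of "\<gamma>\<^sup>2"] by simp
  also have "\<dots> = n * (1 - \<gamma>\<^sup>2 * \<mu> * L) + c * a"
    by (simp add: c_def algebra_simps)
  also have "\<dots> \<le> rate \<mu> L \<sigma> \<gamma> * n"
  proof (cases "0 \<le> c")
    case True
    then have "c * a \<le> c * (L * n)" using up by (rule mult_left_mono[rotated])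
    then have "n * (1 - \<gamma>\<^sup>2 * \<mu> * L) + c * a \<le> ((1 - \<gamma> * L)\<^sup>2 + \<gamma>\<^sup>2 * \<sigma> * L / 2) * n"
      by (simp add: c_def power2_eq_square algebra_simps)
    also have "\<dots> \<le> rate \<mu> L \<sigma> \<gamma> * n"
      by (intro mult_right_mono n) (simp add: rate_def)
    finally show ?thesis .
  next
    case False
    then have "c * a \<le> c * (\<mu> * n)" using low by (intro mult_left_mono_neg) auto
    then have "n * (1 - \<gamma>\<^sup>2 * \<mu> * L) + c * a \<le> ((1 - \<gamma> * \<mu>)\<^sup>2 + \<gamma>\<^sup>2 * \<sigma> * \<mu> / 2) * n"
      by (simp add: c_def power2_eq_square algebra_simps)
    also have "\<dots> \<le> rate \<mu> L \<sigma> \<gamma> * n"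
      by (intro mult_right_mono n) (simp add: rate_def)
    finally show ?thesis .
  qed
  finally show ?thesis
    by (simp add: n_def power2_norm_eq_inner)
qed

section \<open>Size of the rate\<close>

lemma rate_nonneg:
  assumes "0 < \<mu>" "0 \<le> \<sigma>"
  shows "0 \<le> rate \<mu> L \<sigma> \<gamma>"
proof -
  have "0 \<le> (1 - \<gamma> * \<mu>)\<^sup>2 + \<gamma>\<^sup>2 * \<sigma> * \<mu> / 2" using assms by auto
  then show ?thesis by (simp add: rate_def)
qed

text \<open>The factor belonging to an eigenvalue \<open>x\<close> is
  \<open>1 - \<gamma> * x * (2 - \<gamma> * (x + \<sigma> / 2))\<close>. The bound on
  \<open>\<gamma>\<close> makes the bracket positive at \<open>x = L\<close>, hence at all smaller
  \<open>x\<close>.\<close>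

lemma rate_less_1:
  assumes "0 < \<mu>" "\<mu> \<le> L" "0 \<le> \<sigma>" "0 < \<gamma>" "\<gamma> < 2 / (L + \<sigma> / 2)"
  shows "rate \<mu> L \<sigma> \<gamma> < 1"
proof -
  have L: "\<gamma> * (L + \<sigma> / 2) < 2"
    using assms by (simp add: pos_less_divide_eq)
  have "(1 - \<gamma> * x)\<^sup>2 + \<gamma>\<^sup>2 * \<sigma> * x / 2 < 1" if x: "0 < x" "x \<le> L" for x
  proof -
    have "\<gamma> * (x + \<sigma> / 2) \<le> \<gamma> * (L + \<sigma> / 2)"
      using x assms by (intro mult_left_mono) auto
    then have "\<gamma> * (x + \<sigma> / 2) < 2"
      using L by linarith
    then have "0 < (\<gamma> * x) * (2 - \<gamma> * (x + \<sigma> / 2))"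
      using x assms by (intro mult_pos_pos) auto
    then show ?thesis
      by (simp add: power2_eq_square algebra_simps)
  qed
  then show ?thesis using assms by (simp add: rate_def)
qed

section \<open>Geometry near a Polyak-Lojasiewicz minimum\<close>

text \<open>Only the value \<open>f xs\<close> of the reference point enters, so every point of
  \<open>U\<close> with this value is on the same footing as \<open>xs\<close>.\<close>

locale pl_region =
  fixes f :: "'v::euclidean_space \<Rightarrow> real"
    and H :: "'v \<Rightarrow> 'v \<Rightarrow>\<^sub>L 'v"
    and U :: "'v set" and xs :: 'v and \<mu> L :: real
  assumes open_U: "open U"
    and differentiable: "x \<in> U \<Longrightarrow> f differentiable (at x)"
    and hess: "x \<in> U \<Longrightarrow> (gradient f has_derivative blinfun_apply (H x)) (at x)"
    and cont_H: "continuous_on U H"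
    and minimal: "x \<in> U \<Longrightarrow> f xs \<le> f x"
    and pl: "x \<in> U \<Longrightarrow> 2 * \<mu> * (f x - f xs) \<le> (norm (gradient f x))\<^sup>2"
    and lip: "x \<in> U \<Longrightarrow> y \<in> U \<Longrightarrow> norm (gradient f x - gradient f y) \<le> L * norm (x - y)"
    and mu_pos: "0 < \<mu>" and mu_le_L: "\<mu> \<le> L"
begin

lemma has_derivative_f:
  "x \<in> U \<Longrightarrow> (f has_derivative (\<lambda>h. h \<bullet> gradient f x)) (at x)"
  using GDERIV_gradient[OF differentiable] by (simp add: gderiv_def)

lemma continuous_on_f: "continuous_on U f"
  by (meson differentiable continuous_at_imp_continuous_on differentiable_imp_continuous_within)

lemma has_real_derivative_line:
  assumes "x + t *\<^sub>R v \<in> U"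
  shows "((\<lambda>t. f (x + t *\<^sub>R v)) has_real_derivative v \<bullet> gradient f (x + t *\<^sub>R v)) (at t)"
proof -
  have "((\<lambda>t. x + t *\<^sub>R v) has_derivative (\<lambda>s. s *\<^sub>R v)) (at t)"
    by (auto intro!: derivative_eq_intros)
  from has_derivative_compose[OF this has_derivative_f[OF assms]]
  show ?thesis
    by (simp add: has_field_derivative_def mult_commute_abs)
qed

lemma gradient_eq_0:
  assumes "p \<in> U" "f p = f xs"
  shows "gradient f p = 0"
proof -
  have "(\<lambda>h. h \<bullet> gradient f p) = (\<lambda>h. 0)"
    using assms minimal
    by (intro differential_zero_maxmin[OF _ open_U has_derivative_f]) auto
  then show ?thesis
    by (metis inner_eq_zero_iff)
qed

text \<open>The mean value theorem on the segment from \<open>p\<close>, where the gradient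
  vanishes. The constant \<open>L\<close> in place of \<open>L / 2\<close> is harmless: it affects
  prefactors, not the rate.\<close>

lemma f_upper:
  assumes "ball p r \<subseteq> U" "f p = f xs" "x \<in> ball p r"
  shows "f x - f xs \<le> L * (norm (x - p))\<^sup>2"
proof (cases "x = p")
  case False
  define v where "v = x - p"
  have v: "norm v < r" using assms by (simp add: v_def dist_norm norm_minus_commute)
  have r: "0 < r" using v norm_ge_zero[of v] by linarith
  have in_U: "p + t *\<^sub>R v \<in> U" if "0 \<le> t" "t \<le> 1" for t
  proof -
    have "t * norm v \<le> norm v" using that by (simp add: mult_left_le_one_le)
    then show ?thesis using assms(1) v that by (auto simp: dist_norm subset_iff)
  qed
  obtain z where z: "0 < z" "z < 1"
    and eq: "f (p + 1 *\<^sub>R v) - f (p + 0 *\<^sub>R v) = (1 - 0) * (v \<bullet> gradient f (p + z *\<^sub>R v))"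
    using MVT2[of 0 1 "\<lambda>t. f (p + t *\<^sub>R v)" "\<lambda>t. v \<bullet> gradient f (p + t *\<^sub>R v)"]
      has_real_derivative_line[OF in_U] by auto
  have pU: "p \<in> U" using assms(1) r by auto
  have "f x - f xs = v \<bullet> gradient f (p + z *\<^sub>R v)"
    using eq assms(2) by (simp add: v_def)
  also have "\<dots> \<le> norm v * norm (gradient f (p + z *\<^sub>R v))"
    by (rule norm_cauchy_schwarz)
  also have "\<dots> \<le> norm v * (L * norm (z *\<^sub>R v))"
    using lip[OF in_U[of z] pU] z gradient_eq_0[OF pU assms(2)]
    by (intro mult_left_mono) auto
  also have "\<dots> \<le> norm v * (L * norm v)"
    using z mu_pos mu_le_L by (intro mult_left_mono) (auto simp: mult_left_le_one_le)
  finally show ?thesis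
    by (simp add: v_def power2_eq_square mult_ac)
qed (use assms in auto)

text \<open>
  Ekeland's argument: a minimiser \<open>y\<close> of \<open>sqrt (f y - f xs) + sqrt \<mu> / 2 * norm (y - x)\<close> has
  \<open>f y = f xs\<close>, since otherwise the gradient of the first summand has norm at least
  \<open>sqrt (\<mu> / 2)\<close>, so that a small gradient step decreases the sum.
\<close>

lemma quadratic_growth:
  assumes sub: "cball x s \<subseteq> U" and s: "0 \<le> s" and small: "4 * (f x - f xs) < \<mu> * s\<^sup>2"
  shows "\<exists>y\<in>cball x s. f y = f xs \<and> \<mu> * (norm (y - x))\<^sup>2 \<le> 4 * (f x - f xs)"
proof -
  \<comment> \<open>This slope is strictly below \<open>sqrt (\<mu> / 2)\<close>, so at a point with
    \<open>f y \<noteq> f xs\<close> the square root falls strictly faster along \<open>- g\<close>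
    than the penalty grows.\<close>
  define c where "c = sqrt \<mu> / 2"
  have c: "0 < c" "4 * c\<^sup>2 = \<mu>" using mu_pos by (auto simp: c_def power_divide)
  define \<phi> where "\<phi> y = sqrt (f y - f xs)" for y
  have xU: "x \<in> U" using sub s by auto
  have "continuous_on (cball x s) (\<lambda>y. \<phi> y + c * norm (y - x))"
    unfolding \<phi>_def by (intro continuous_intros continuous_on_subset[OF continuous_on_f sub])
  then obtain y where y: "y \<in> cball x s"
    and ymin: "\<And>z. z \<in> cball x s \<Longrightarrow> \<phi> y + c * norm (y - x) \<le> \<phi> z + c * norm (z - x)"
    using continuous_attains_inf[of "cball x s"] s by force
  have yU: "y \<in> U" using y sub by auto
  have \<phi>y: "0 \<le> \<phi> y" "(\<phi> y)\<^sup>2 = f y - f xs" using minimal[OF yU] by (auto simp: \<phi>_def)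
  have "c * norm (y - x) \<le> \<phi> x"
    using ymin[of x] s \<phi>y(1) by simp
  then have "(c * norm (y - x))\<^sup>2 \<le> (\<phi> x)\<^sup>2"
    using c by (intro power_mono) auto
  then have dist: "\<mu> * (norm (y - x))\<^sup>2 \<le> 4 * (f x - f xs)"
    using minimal[OF xU] by (simp add: \<phi>_def power_mult_distrib flip: c(2))
  then have "\<mu> * (norm (y - x))\<^sup>2 < \<mu> * s\<^sup>2" using small by linarith
  \<comment> \<open>By \<open>small\<close> the minimiser is interior, so a short step away from it
    stays in the ball.\<close>
  then have ys: "norm (y - x) < s"
    using mu_pos s by (simp add: power2_less_imp_less)
  have "f y = f xs"
  proof (rule ccontr)
    assume "f y \<noteq> f xs"
    then have pos: "0 < f y - f xs" using minimal[OF yU] by auto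
    then have \<phi>pos: "0 < \<phi> y" by (simp add: \<phi>_def)
    define g where "g = gradient f y"
    have "(2 * c * \<phi> y)\<^sup>2 = \<mu> * (f y - f xs)"
      by (simp add: power_mult_distrib \<phi>y c(2)[symmetric])
    also have "\<dots> < 2 * \<mu> * (f y - f xs)" using pos mu_pos by simp
    also have "\<dots> \<le> (norm g)\<^sup>2" unfolding g_def by (rule pl[OF yU])
    finally have g: "2 * c * \<phi> y < norm g"
      by (rule power2_less_imp_less) simp
    have gpos: "0 < norm g" using g c \<phi>pos by (smt (verit) mult_pos_pos)
    define h where "h t = sqrt (f (y + t *\<^sub>R (- g)) - f xs) + c * t * norm g" for t
    have df: "((\<lambda>t. f (y + t *\<^sub>R (- g)) - f xs) has_real_derivative - (norm g)\<^sup>2) (at 0)"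
      using DERIV_diff[OF has_real_derivative_line[of y 0 "- g"] DERIV_const] yU
      by (simp add: g_def power2_norm_eq_inner)
    have ds: "((\<lambda>t. sqrt (f (y + t *\<^sub>R (- g)) - f xs)) has_real_derivative
        inverse (\<phi> y) / 2 * - (norm g)\<^sup>2) (at 0)"
      using DERIV_chain2[OF _ df, of sqrt "inverse (\<phi> y) / 2"] DERIV_real_sqrt[OF pos]
      by (simp add: \<phi>_def)
    have dl: "((\<lambda>t. c * t * norm g) has_real_derivative c * norm g) (at 0)"
      by (auto intro!: derivative_eq_intros)
    have "(h has_real_derivative (- (norm g)\<^sup>2 * (inverse (\<phi> y) / 2) + c * norm g)) (at 0)"
      unfolding h_def using DERIV_add[OF ds dl] by (simp add: mult.commute)
    moreover have "- (norm g)\<^sup>2 * (inverse (\<phi> y) / 2) + c * norm g < 0"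
    proof -
      have "norm g * (2 * c * \<phi> y) < norm g * norm g"
        using g gpos by (intro mult_strict_left_mono)
      then show ?thesis using \<phi>pos by (simp add: field_simps power2_eq_square)
    qed
    ultimately obtain d where d: "0 < d" "\<And>t. 0 < t \<Longrightarrow> t < d \<Longrightarrow> h (0 + t) < h 0"
      using DERIV_neg_dec_right by blast
    define t where "t = min (d / 2) ((s - norm (y - x)) / norm g)"
    have t: "0 < t" "t < d" "t * norm g \<le> s - norm (y - x)"
    proof -
      show "0 < t" "t < d" using d ys gpos by (auto simp: t_def)
      have "t \<le> (s - norm (y - x)) / norm g" by (simp add: t_def)
      then show "t * norm g \<le> s - norm (y - x)" using gpos by (simp add: field_simps)
    qed
    let ?z = "y + t *\<^sub>R (- g)"
    have nz: "norm (?z - x) \<le> norm (y - x) + t * norm g"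
      using norm_triangle_ineq4[of "y - x" "t *\<^sub>R g"] t(1) by (simp add: algebra_simps)
    then have "?z \<in> cball x s" using t(3) by (simp add: dist_norm norm_minus_commute)
    from ymin[OF this] have "\<phi> y + c * norm (y - x) \<le> \<phi> ?z + c * (norm (y - x) + t * norm g)"
      using nz c(1) by (smt (verit) mult_left_mono)
    then have "h 0 \<le> h t" by (simp add: h_def \<phi>_def algebra_simps)
    then show False using d(2)[of t] t by simp
  qed
  with y dist show ?thesis by blast
qed

section \<open>Taylor estimates and the Hessian at a minimum\<close>

lemma hess_continuity:
  assumes "p \<in> U" "0 < \<omega>"
  obtains \<eta> where "0 < \<eta>" "ball p \<eta> \<subseteq> U" "\<And>z. z \<in> ball p \<eta> \<Longrightarrow> norm (H z - H p) \<le> \<omega>"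
proof -
  obtain e where e: "0 < e" "ball p e \<subseteq> U" using open_U assms(1) by (meson open_contains_ball)
  obtain d where d: "0 < d" "\<And>z. z \<in> U \<Longrightarrow> dist z p < d \<Longrightarrow> dist (H z) (H p) < \<omega>"
    using cont_H assms by (force simp: continuous_on_iff)
  show ?thesis
  proof (rule that)
    show "0 < min d e" "ball p (min d e) \<subseteq> U" using d e by auto
    fix z assume "z \<in> ball p (min d e)"
    then show "norm (H z - H p) \<le> \<omega>"
      using d(2)[of z] e(2) by (auto simp: dist_norm norm_minus_commute intro!: less_imp_le)
  qed
qed

text \<open>The mean value inequality for \<open>gradient f\<close> minus the linear map
  \<open>H p\<close>, whose derivative at \<open>x\<close> is \<open>H x - H p\<close>.\<close>

lemma gradient_linearization:
  assumes "ball p \<eta> \<subseteq> U" "\<And>z. z \<in> ball p \<eta> \<Longrightarrow> norm (H z - H p) \<le> \<omega>"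
    and "y \<in> ball p \<eta>" "z \<in> ball p \<eta>"
  shows "norm (gradient f y - gradient f z - H p (y - z)) \<le> \<omega> * norm (y - z)"
proof -
  have "norm ((gradient f y - H p y) - (gradient f z - H p z)) \<le> \<omega> * norm (y - z)"
  proof (rule differentiable_bound[OF convex_ball _ _ assms(3,4)])
    fix x assume x: "x \<in> ball p \<eta>"
    then have "(gradient f has_derivative blinfun_apply (H x)) (at x)"
      using hess assms(1) by auto
    then have "((\<lambda>x. gradient f x - H p x) has_derivative (\<lambda>h. H x h - H p h)) (at x)"
      by (rule has_derivative_diff[OF _ bounded_linear_imp_has_derivative[OF blinfun.bounded_linear_right]])
    moreover have "(\<lambda>h. H x h - H p h) = blinfun_apply (H x - H p)"
      by (simp add: fun_eq_iff blinfun.diff_left)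
    ultimately show "((\<lambda>x. gradient f x - H p x) has_derivative blinfun_apply (H x - H p))
        (at x within ball p \<eta>)"
      by (simp only: has_derivative_at_withinI)
    show "onorm (blinfun_apply (H x - H p)) \<le> \<omega>"
      using assms(2)[OF x] by (simp add: norm_blinfun.rep_eq)
  qed
  then show ?thesis by (simp add: blinfun.diff_right algebra_simps)
qed

lemma second_order_expansion:
  assumes sub: "ball p \<eta> \<subseteq> U" and H: "\<And>z. z \<in> ball p \<eta> \<Longrightarrow> norm (H z - H p) \<le> \<omega>"
    and v: "norm v < \<eta>" and p: "f p = f xs"
  shows "\<bar>f (p + v) - f xs - H p v \<bullet> v / 2\<bar> \<le> \<omega> * (norm v)\<^sup>2"
proof -
  have \<eta>: "0 < \<eta>" using v norm_ge_zero[of v] by linarith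
  then have pU: "p \<in> U" using sub by auto
  have \<omega>: "0 \<le> \<omega>" using H[of p] \<eta> by simp
  have in_ball: "p + t *\<^sub>R v \<in> ball p \<eta>" if "0 \<le> t" "t \<le> 1" for t
  proof -
    have "t * norm v \<le> norm v" using that by (simp add: mult_left_le_one_le)
    then show ?thesis using v that by (auto simp: dist_norm)
  qed
  \<comment> \<open>With the quadratic term subtracted, and since the gradient vanishes at
    \<open>p\<close>, the derivative of \<open>F\<close> is \<open>v\<close> paired with the
    linearisation error of the gradient.\<close>
  define F where "F t = f (p + t *\<^sub>R v) - t\<^sup>2 / 2 * (H p v \<bullet> v)" for t
  have "(F has_real_derivative v \<bullet> gradient f (p + t *\<^sub>R v) - t * (H p v \<bullet> v)) (at t)"
    if "0 \<le> t" "t \<le> 1" for t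
    unfolding F_def using has_real_derivative_line[of p t v] in_ball[OF that] sub
    by (auto intro!: derivative_eq_intros)
  then obtain z where z: "0 < z" "z < 1"
    and eq: "F 1 - F 0 = (1 - 0) * (v \<bullet> gradient f (p + z *\<^sub>R v) - z * (H p v \<bullet> v))"
    using MVT2[of 0 1 F "\<lambda>t. v \<bullet> gradient f (p + t *\<^sub>R v) - t * (H p v \<bullet> v)"] by auto
  have "f (p + v) - f xs - H p v \<bullet> v / 2 = v \<bullet> (gradient f (p + z *\<^sub>R v) - gradient f p - H p (z *\<^sub>R v))"
    using eq p gradient_eq_0[OF pU p]
    by (simp add: F_def inner_diff blinfun.scaleR_right inner_commute)
  also have "\<bar>\<dots>\<bar> \<le> norm v * norm (gradient f (p + z *\<^sub>R v) - gradient f p - H p (z *\<^sub>R v))"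
    by (rule Cauchy_Schwarz_ineq2)
  also have "\<dots> \<le> norm v * (\<omega> * norm (z *\<^sub>R v))"
    using gradient_linearization[OF sub H in_ball[of z], of p] z \<eta>
    by (intro mult_left_mono) auto
  also have "\<dots> \<le> norm v * (\<omega> * norm v)"
    using z \<omega> by (intro mult_left_mono) (auto simp: mult_left_le_one_le)
  finally show ?thesis by (simp add: power2_eq_square mult_ac)
qed

text \<open>The second difference is unchanged when \<open>x\<close> and \<open>y\<close> are
  exchanged, so estimating it in both orders shows that the Hessian is symmetric, as in the
  classical theorem of Schwarz. The mean value theorem is applied in direction \<open>x\<close> to
  the difference in direction \<open>y\<close>.\<close>

lemma second_difference:
  assumes sub: "ball p \<eta> \<subseteq> U" and H: "\<And>z. z \<in> ball p \<eta> \<Longrightarrow> norm (H z - H p) \<le> \<omega>"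
    and t: "0 < t" "t * (norm x + norm y) < \<eta>"
  shows "\<bar>f (p + t *\<^sub>R y + t *\<^sub>R x) - f (p + t *\<^sub>R x) - f (p + t *\<^sub>R y) + f p - t\<^sup>2 * (x \<bullet> H p y)\<bar>
    \<le> t\<^sup>2 * (\<omega> * norm x * norm y)"
proof -
  have \<eta>: "0 < \<eta>" using t by (smt (verit) mult_nonneg_nonneg norm_ge_zero)
  have \<omega>: "0 \<le> \<omega>" using H[of p] \<eta> by simp
  have bnd: "norm (r *\<^sub>R y + s *\<^sub>R x) < \<eta>" if "0 \<le> r" "r \<le> t" "0 \<le> s" "s \<le> t" for r s
  proof -
    have "norm (r *\<^sub>R y + s *\<^sub>R x) \<le> r * norm y + s * norm x"
      using norm_triangle_ineq[of "r *\<^sub>R y" "s *\<^sub>R x"] that by simp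
    also have "\<dots> \<le> t * norm y + t * norm x"
      using that by (intro add_mono mult_right_mono) auto
    finally show ?thesis using t by (simp add: algebra_simps)
  qed
  have in_ball: "p + r *\<^sub>R y + s *\<^sub>R x \<in> ball p \<eta>" if "0 \<le> r" "r \<le> t" "0 \<le> s" "s \<le> t" for r s
    using bnd[OF that] by (simp add: dist_norm add.assoc flip: norm_minus_cancel[of "r *\<^sub>R y + s *\<^sub>R x"])
  have in_U: "p + r *\<^sub>R y + s *\<^sub>R x \<in> U" if "0 \<le> r" "r \<le> t" "0 \<le> s" "s \<le> t" for r s
    using in_ball[OF that] sub by blast
  define K where "K s = f (p + t *\<^sub>R y + s *\<^sub>R x) - f (p + 0 *\<^sub>R y + s *\<^sub>R x)" for s
  define K' where "K' s = x \<bullet> gradient f (p + t *\<^sub>R y + s *\<^sub>R x)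
    - x \<bullet> gradient f (p + 0 *\<^sub>R y + s *\<^sub>R x)" for s
  have "(K has_real_derivative K' s) (at s)" if "0 \<le> s" "s \<le> t" for s
    unfolding K_def K'_def
    by (intro DERIV_diff has_real_derivative_line in_U) (use that t in auto)
  then obtain z where z: "0 < z" "z < t" and eq: "K t - K 0 = (t - 0) * K' z"
    using MVT2[OF t(1)] by blast
  let ?a = "p + t *\<^sub>R y + z *\<^sub>R x" and ?b = "p + 0 *\<^sub>R y + z *\<^sub>R x"
  have "f (p + t *\<^sub>R y + t *\<^sub>R x) - f (p + t *\<^sub>R x) - f (p + t *\<^sub>R y) + f p - t\<^sup>2 * (x \<bullet> H p y)
      = t * (x \<bullet> (gradient f ?a - gradient f ?b - H p (?a - ?b)))"
    using eq by (simp add: K_def K'_def inner_diff blinfun.scaleR_right algebra_simps power2_eq_square)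
  also have "\<bar>\<dots>\<bar> \<le> t * (norm x * norm (gradient f ?a - gradient f ?b - H p (?a - ?b)))"
    using t by (simp add: abs_mult Cauchy_Schwarz_ineq2)
  also have "\<dots> \<le> t * (norm x * (\<omega> * norm (?a - ?b)))"
    using t z by (intro mult_left_mono gradient_linearization[OF sub H] in_ball) auto
  also have "\<dots> = t\<^sup>2 * (\<omega> * norm x * norm y)"
    using t by (simp add: power2_eq_square)
  finally show ?thesis .
qed

lemma hess_symmetric:
  assumes "p \<in> U"
  shows "H p x \<bullet> y = x \<bullet> H p y"
proof -
  have bound: "\<bar>H p x \<bullet> y - x \<bullet> H p y\<bar> \<le> 2 * (norm x * norm y) * \<omega>" if \<omega>: "0 < \<omega>" for \<omega>
  proof -
    obtain \<eta> where \<eta>: "0 < \<eta>" "ball p \<eta> \<subseteq> U" "\<And>z. z \<in> ball p \<eta> \<Longrightarrow> norm (H z - H p) \<le> \<omega>"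
      using hess_continuity[OF assms \<omega>] by blast
    define t where "t = \<eta> / (norm x + norm y + 1)"
    have "0 < norm x + norm y + 1" by (simp add: add_nonneg_pos)
    then have t: "0 < t" "t * (norm x + norm y) < \<eta>"
      using \<eta>(1) by (auto simp: t_def field_simps)
    have "\<bar>t\<^sup>2 * (y \<bullet> H p x) - t\<^sup>2 * (x \<bullet> H p y)\<bar> \<le> 2 * (t\<^sup>2 * (\<omega> * norm x * norm y))"
      using second_difference[OF \<eta>(2,3) t] second_difference[OF \<eta>(2,3) t(1), of y x] t(2)
      by (simp add: ac_simps)
    then have "t\<^sup>2 * \<bar>y \<bullet> H p x - x \<bullet> H p y\<bar> \<le> t\<^sup>2 * (2 * (norm x * norm y) * \<omega>)"
      by (simp add: right_diff_distrib[symmetric] abs_mult mult_ac)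
    then show ?thesis using t by (simp add: inner_commute)
  qed
  have "((\<lambda>\<omega>. 2 * (norm x * norm y) * \<omega>) \<longlongrightarrow> 2 * (norm x * norm y) * 0) (at_right 0)"
    by (intro tendsto_intros)
  then have "\<bar>H p x \<bullet> y - x \<bullet> H p y\<bar> \<le> 2 * (norm x * norm y) * 0"
    by (rule tendsto_lowerbound)
      (auto intro!: bound eventually_at_right_less[THEN eventually_mono])
  then show ?thesis by simp
qed

text \<open>One step size at which both the gradient and the value along \<open>v\<close> agree with
  their Taylor terms up to \<open>\<omega>\<close>, after division by \<open>t\<close> and
  \<open>t\<^sup>2\<close>. This transfers inequalities valid on \<open>U\<close> to the
  Hessian.\<close>

lemma hess_directional:
  assumes p: "p \<in> U" "f p = f xs" and \<omega>: "0 < \<omega>"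
  obtains t where "0 < t" "p + t *\<^sub>R v \<in> U"
    "norm (gradient f (p + t *\<^sub>R v) - t *\<^sub>R H p v) \<le> t * \<omega>"
    "\<bar>f (p + t *\<^sub>R v) - f xs - t\<^sup>2 * (H p v \<bullet> v / 2)\<bar> \<le> t\<^sup>2 * \<omega>"
proof -
  let ?n = "norm v + 1"
  \<comment> \<open>The scaling makes \<open>\<omega>' * norm v\<close> and
    \<open>\<omega>' * (norm v)\<^sup>2\<close> both at most \<open>\<omega>\<close>; adding 1 to
    the norm covers \<open>v = 0\<close>.\<close>
  define \<omega>' where "\<omega>' = \<omega> / ?n\<^sup>2"
  have n: "1 \<le> ?n" by simp
  have n0: "0 < ?n" using n by linarith
  have \<omega>': "0 < \<omega>'" using \<omega> n0 by (simp add: \<omega>'_def)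
  have "\<omega>' * ?n * 1 \<le> \<omega>' * ?n * ?n" using \<omega>' n n0 by (intro mult_left_mono) auto
  also have "\<dots> = \<omega>" using n0 by (simp add: \<omega>'_def power2_eq_square)
  finally have "\<omega>' * ?n \<le> \<omega>" by simp
  then have w1: "\<omega>' * norm v \<le> \<omega>"
    using \<omega>' by (simp add: algebra_simps)
  have "\<omega>' * (norm v)\<^sup>2 \<le> \<omega>' * ?n\<^sup>2"
    using \<omega>' by (intro mult_left_mono power_mono) auto
  also have "\<dots> = \<omega>" using n0 by (simp add: \<omega>'_def)
  finally have w2: "\<omega>' * (norm v)\<^sup>2 \<le> \<omega>" .
  obtain \<eta> where \<eta>: "0 < \<eta>" "ball p \<eta> \<subseteq> U" "\<And>z. z \<in> ball p \<eta> \<Longrightarrow> norm (H z - H p) \<le> \<omega>'"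
    using hess_continuity[OF p(1) \<omega>'] by blast
  define t where "t = \<eta> / ?n"
  have t: "0 < t" "norm (t *\<^sub>R v) < \<eta>"
    using \<eta>(1) n0 by (auto simp: t_def field_simps)
  have tb: "p + t *\<^sub>R v \<in> ball p \<eta>" using t by (simp add: dist_norm)
  show ?thesis
  proof (rule that[OF t(1)])
    show "p + t *\<^sub>R v \<in> U" using tb \<eta>(2) by auto
    have "norm (gradient f (p + t *\<^sub>R v) - t *\<^sub>R H p v) \<le> \<omega>' * norm (t *\<^sub>R v)"
      using gradient_linearization[OF \<eta>(2,3) tb, of p] gradient_eq_0[OF p] \<eta>(1)
      by (simp add: blinfun.scaleR_right)
    also have "\<dots> \<le> t * \<omega>" using t w1 by (simp add: mult.left_commute)
    finally show "norm (gradient f (p + t *\<^sub>R v) - t *\<^sub>R H p v) \<le> t * \<omega>" .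
    have "\<bar>f (p + t *\<^sub>R v) - f xs - t\<^sup>2 * (H p v \<bullet> v / 2)\<bar> \<le> \<omega>' * (norm (t *\<^sub>R v))\<^sup>2"
      using second_order_expansion[OF \<eta>(2,3) t(2) p(2)]
      by (simp add: blinfun.scaleR_right power2_eq_square)
    also have "\<dots> \<le> t\<^sup>2 * \<omega>" using t w2 by (simp add: mult.left_commute power_mult_distrib)
    finally show "\<bar>f (p + t *\<^sub>R v) - f xs - t\<^sup>2 * (H p v \<bullet> v / 2)\<bar> \<le> t\<^sup>2 * \<omega>" .
  qed
qed

text \<open>Minimality, the Polyak-Lojasiewicz inequality and the Lipschitz bound are evaluated at
  \<open>p + t *\<^sub>R v\<close>, divided by the power of \<open>t\<close> with which they scale,
  and passed to the limit in the tolerance \<open>\<omega>\<close>.\<close>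

lemma
  assumes p: "p \<in> U" "f p = f xs"
  shows hess_psd: "0 \<le> H p v \<bullet> v"
    and hess_pl: "\<mu> * (H p v \<bullet> v) \<le> (norm (H p v))\<^sup>2"
    and hess_lip: "norm (H p v) \<le> L * norm v"
proof -
  have pU: "gradient f p = 0" using gradient_eq_0[OF p] .
  have 1: "0 \<le> H p v \<bullet> v / 2 + \<omega>" if \<omega>: "0 < \<omega>" for \<omega>
  proof -
    obtain t where t: "0 < t" "p + t *\<^sub>R v \<in> U"
      and e: "\<bar>f (p + t *\<^sub>R v) - f xs - t\<^sup>2 * (H p v \<bullet> v / 2)\<bar> \<le> t\<^sup>2 * \<omega>"
      using hess_directional[OF p \<omega>, of v] by metis
    have "0 \<le> t\<^sup>2 * (H p v \<bullet> v / 2 + \<omega>)"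
      using e minimal[OF t(2)] by (simp add: algebra_simps)
    then show ?thesis using t by (simp add: zero_le_mult_iff)
  qed
  have "((\<lambda>\<omega>. H p v \<bullet> v / 2 + \<omega>) \<longlongrightarrow> H p v \<bullet> v / 2 + 0) (at_right 0)"
    by (intro tendsto_intros)
  then have "0 \<le> H p v \<bullet> v / 2 + 0"
    by (rule tendsto_lowerbound) (auto intro!: 1 eventually_at_right_less[THEN eventually_mono])
  then show "0 \<le> H p v \<bullet> v" by simp

  have 2: "\<mu> * (H p v \<bullet> v) \<le> (norm (H p v) + \<omega>)\<^sup>2 + 2 * \<mu> * \<omega>" if \<omega>: "0 < \<omega>" for \<omega>
  proof -
    obtain t where t: "0 < t" "p + t *\<^sub>R v \<in> U"
      and g: "norm (gradient f (p + t *\<^sub>R v) - t *\<^sub>R H p v) \<le> t * \<omega>"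
      and e: "\<bar>f (p + t *\<^sub>R v) - f xs - t\<^sup>2 * (H p v \<bullet> v / 2)\<bar> \<le> t\<^sup>2 * \<omega>"
      using hess_directional[OF p \<omega>, of v] by metis
    have "t\<^sup>2 * (H p v \<bullet> v / 2 - \<omega>) \<le> f (p + t *\<^sub>R v) - f xs"
      using e by (simp add: algebra_simps abs_le_iff)
    then have "2 * \<mu> * (t\<^sup>2 * (H p v \<bullet> v / 2 - \<omega>)) \<le> 2 * \<mu> * (f (p + t *\<^sub>R v) - f xs)"
      using mu_pos by (intro mult_left_mono) auto
    also have "\<dots> \<le> (norm (gradient f (p + t *\<^sub>R v)))\<^sup>2"
      by (rule pl[OF t(2)])
    also have "\<dots> \<le> (t * (norm (H p v) + \<omega>))\<^sup>2"
      using g norm_triangle_sub[of "gradient f (p + t *\<^sub>R v)" "t *\<^sub>R H p v"] t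
      by (intro power_mono) (auto simp: algebra_simps)
    finally have "t\<^sup>2 * (\<mu> * (H p v \<bullet> v)) \<le> t\<^sup>2 * ((norm (H p v) + \<omega>)\<^sup>2 + 2 * \<mu> * \<omega>)"
      unfolding power_mult_distrib by (simp add: algebra_simps)
    then show ?thesis using t by simp
  qed
  have "((\<lambda>\<omega>. (norm (H p v) + \<omega>)\<^sup>2 + 2 * \<mu> * \<omega>) \<longlongrightarrow> (norm (H p v) + 0)\<^sup>2 + 2 * \<mu> * 0) (at_right 0)"
    by (intro tendsto_intros)
  then have "\<mu> * (H p v \<bullet> v) \<le> (norm (H p v) + 0)\<^sup>2 + 2 * \<mu> * 0"
    by (rule tendsto_lowerbound) (auto intro!: 2 eventually_at_right_less[THEN eventually_mono])
  then show "\<mu> * (H p v \<bullet> v) \<le> (norm (H p v))\<^sup>2" by simp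

  have 3: "norm (H p v) \<le> L * norm v + \<omega>" if \<omega>: "0 < \<omega>" for \<omega>
  proof -
    obtain t where t: "0 < t" "p + t *\<^sub>R v \<in> U"
      and g: "norm (gradient f (p + t *\<^sub>R v) - t *\<^sub>R H p v) \<le> t * \<omega>"
      using hess_directional[OF p \<omega>, of v] by metis
    have "t * norm (H p v) \<le> norm (gradient f (p + t *\<^sub>R v)) + t * \<omega>"
      using g norm_triangle_sub[of "t *\<^sub>R H p v" "gradient f (p + t *\<^sub>R v)"] t
      by (simp add: norm_minus_commute)
    also have "\<dots> \<le> t * (L * norm v + \<omega>)"
      using lip[OF t(2) p(1)] t by (simp add: pU algebra_simps)
    finally show ?thesis using t by simp
  qed
  then show "norm (H p v) \<le> L * norm v"
    by (rule field_le_epsilon)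
qed

section \<open>The set of minima and its nearest points\<close>

definition minima :: "real \<Rightarrow> 'v set" where
  "minima R = {p \<in> cball xs R. f p = f xs}"

lemma xs_in_minima: "0 \<le> R \<Longrightarrow> xs \<in> minima R"
  by (simp add: minima_def)

lemma compact_minima:
  assumes "cball xs R \<subseteq> U"
  shows "compact (minima R)"
proof -
  have "continuous_on (cball xs R) f"
    by (rule continuous_on_subset[OF continuous_on_f assms])
  then have "closedin (top_of_set (cball xs R)) (cball xs R \<inter> f -` {f xs})"
    by (rule continuous_closedin_preimage) simp
  then have "compact (cball xs R \<inter> f -` {f xs})"
    by (rule closedin_compact[OF compact_cball])
  moreover have "cball xs R \<inter> f -` {f xs} = minima R" by (auto simp: minima_def)
  ultimately show ?thesis by simp
qed

text \<open>Since \<open>xs\<close> is itself a minimum, the distance is below \<open>R / 4\<close>,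
  which puts the nearest minimum in the half ball. Away from the boundary of the cutoff, it still
  has a ball of radius \<open>R / 4\<close> around it inside \<open>U\<close>.\<close>

lemma nearest_minimum:
  assumes "cball xs R \<subseteq> U" "0 < R" "x \<in> ball xs (R / 4)"
  obtains p where "p \<in> minima R" "infdist x (minima R) = norm (x - p)"
    "norm (x - p) < R / 4" "p \<in> ball xs (R / 2)"
proof -
  have ne: "minima R \<noteq> {}" using xs_in_minima[of R] assms by auto
  have "closed (minima R)" using compact_minima[OF assms(1)] by (rule compact_imp_closed)
  from infdist_attains_inf[OF this ne, of x] obtain p
    where p: "p \<in> minima R" "infdist x (minima R) = dist x p" by blast
  have "dist x p \<le> dist x xs"
    using infdist_le[OF xs_in_minima, of R x] assms p by simp
  then have *: "dist x p < R / 4" using assms by (simp add: dist_commute)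
  then have "dist xs p < R / 2"
    using dist_triangle[of xs p x] assms(3) by simp
  with * p show ?thesis using that by (auto simp: dist_norm)
qed

text \<open>
  The displacement \<open>u = x - p\<close> from a nearest minimum is almost orthogonal to the kernel of the
  Hessian at \<open>p\<close>: if \<open>v\<close> is its kernel component, then \<open>f (p + v) - f xs\<close> is of smaller order than
  \<open>norm u ^ 2\<close>, so by quadratic growth there is a minimum close to \<open>p + v\<close>, and it would be nearer
  to \<open>x\<close> than \<open>p\<close> unless \<open>v\<close> is small.
\<close>

lemma nearest_minimum_displacement:
  assumes R: "cball xs R \<subseteq> U" "0 < R"
    and p: "p \<in> minima R" "p \<in> ball xs (R / 2)"
    and nearest: "\<And>q. q \<in> minima R \<Longrightarrow> norm (x - p) \<le> norm (x - q)"
    and x: "norm (x - p) < R / 4" "norm (x - p) < \<eta>"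
    and sub: "ball p \<eta> \<subseteq> U"
    and \<kappa>: "0 < \<kappa>" "\<kappa> < 1"
    and H: "\<And>z. z \<in> ball p \<eta> \<Longrightarrow> norm (H z - H p) \<le> \<mu> * \<kappa>\<^sup>2 / 4"
  obtains v w where "x - p = v + w" "H p v = 0" "w \<in> range (H p)" "\<And>z. v \<bullet> H p z = 0"
    "(norm v)\<^sup>2 \<le> 2 * \<kappa> * (norm (x - p))\<^sup>2"
proof -
  have pU: "p \<in> U" and fp: "f p = f xs" using p R by (auto simp: minima_def)
  define u where "u = x - p"
  interpret Hp: linear "blinfun_apply (H p)"
    by (rule bounded_linear.linear[OF blinfun.bounded_linear_right])
  have "subspace (range (H p))"
    by (rule linear_subspace_image[OF Hp.linear_axioms subspace_UNIV])
  then have span: "span (range (H p)) = range (H p)" by (simp add: span_eq_iff)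
  obtain w v where w: "w \<in> range (H p)" and v: "\<And>z. z \<in> range (H p) \<Longrightarrow> orthogonal v z"
    and u: "u = w + v"
    using orthogonal_subspace_decomp_exists[of "range (H p)" u] span by metis
  have vz: "v \<bullet> H p z = 0" for z using v[of "H p z"] by (simp add: orthogonal_def)
  \<comment> \<open>By symmetry, a vector orthogonal to the range lies in the kernel.\<close>
  then have "H p v \<bullet> H p v = 0"
    using hess_symmetric[OF pU, of v "H p v"] by simp
  then have Hv: "H p v = 0" by simp
  have vw: "v \<bullet> w = 0" using vz w by auto
  have nu: "(norm u)\<^sup>2 = (norm v)\<^sup>2 + (norm w)\<^sup>2"
    unfolding u power2_norm_eq_inner using vw by (simp add: inner_add inner_commute)
  have nv: "norm v \<le> norm u"
    by (rule power2_le_imp_le) (simp_all add: nu)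
  have "(norm v)\<^sup>2 \<le> 2 * \<kappa> * (norm u)\<^sup>2"
  proof (cases "u = 0")
    case True
    then show ?thesis using nv by simp
  next
    case False
    then have upos: "0 < norm u" by simp
    define y where "y = p + v"
    \<comment> \<open>The quadratic term vanishes because \<open>v\<close> lies in the kernel; only
      the error of the expansion is left.\<close>
    have "\<bar>f y - f xs\<bar> \<le> \<mu> * \<kappa>\<^sup>2 / 4 * (norm v)\<^sup>2"
      using second_order_expansion[OF sub H _ fp, of v] nv x(2) Hv by (simp add: y_def u_def)
    also have "\<dots> \<le> \<mu> * \<kappa>\<^sup>2 / 4 * (norm u)\<^sup>2"
      using nv mu_pos by (intro mult_left_mono power_mono) auto
    finally have "f y - f xs \<le> \<mu> * \<kappa>\<^sup>2 / 4 * (norm u)\<^sup>2" by linarith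
    then have fy: "4 * (f y - f xs) \<le> \<mu> * (\<kappa> * norm u)\<^sup>2"
      by (simp add: power_mult_distrib)
    have "\<kappa> * norm u < norm u" using \<kappa> upos by simp
    then have "\<mu> * (\<kappa> * norm u)\<^sup>2 < \<mu> * (norm u)\<^sup>2"
      using mu_pos \<kappa> by (simp add: power_strict_mono)
    with fy have small: "4 * (f y - f xs) < \<mu> * (norm u)\<^sup>2" by simp
    have cb: "cball y (norm u) \<subseteq> cball xs R"
    proof
      fix z assume "z \<in> cball y (norm u)"
      then have "dist y z \<le> norm u" by simp
      moreover have "dist p y \<le> norm u" using nv by (simp add: y_def dist_norm)
      moreover have "dist xs p < R / 2" using p(2) by simp
      moreover have "norm u < R / 4" using x by (simp add: u_def)
      ultimately show "z \<in> cball xs R"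
        using dist_triangle[of xs z p] dist_triangle[of p z y] by simp
    qed
    obtain q where q: "q \<in> cball y (norm u)" "f q = f xs"
      and qy: "\<mu> * (norm (q - y))\<^sup>2 \<le> 4 * (f y - f xs)"
      using quadratic_growth[of y "norm u"] small cb R by fastforce
    have "q \<in> minima R" using q cb by (auto simp: minima_def)
    \<comment> \<open>As \<open>x - y = w\<close>, the distance from \<open>q\<close> to
      \<open>x\<close> exceeds \<open>norm w\<close> by at most \<open>\<kappa> * norm u\<close>.
      Being no nearer than \<open>p\<close>, the competitor \<open>q\<close> forces
      \<open>norm w\<close> to be almost \<open>norm u\<close>, and Pythagoras makes
      \<open>v\<close> small.\<close>
    then have "norm u \<le> norm (x - q)" using nearest u_def by simp
    also have "\<dots> \<le> norm w + norm (q - y)"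
      using norm_triangle_ineq4[of w "q - y"] u by (simp add: y_def u_def algebra_simps)
    also have "norm (q - y) \<le> \<kappa> * norm u"
    proof (rule power2_le_imp_le)
      have "\<mu> * (norm (q - y))\<^sup>2 \<le> \<mu> * (\<kappa> * norm u)\<^sup>2" using qy fy by simp
      then show "(norm (q - y))\<^sup>2 \<le> (\<kappa> * norm u)\<^sup>2" using mu_pos by simp
    qed (use \<kappa> in auto)
    finally have "(1 - \<kappa>) * norm u \<le> norm w" by (simp add: algebra_simps)
    then have "((1 - \<kappa>) * norm u)\<^sup>2 \<le> (norm w)\<^sup>2"
      using \<kappa> by (intro power_mono) auto
    then have "(1 - \<kappa>)\<^sup>2 * (norm u)\<^sup>2 \<le> (norm u)\<^sup>2 - (norm v)\<^sup>2"
      by (simp add: nu power_mult_distrib)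
    moreover have "(1 - \<kappa>)\<^sup>2 * (norm u)\<^sup>2 = (norm u)\<^sup>2 - 2 * \<kappa> * (norm u)\<^sup>2 + \<kappa>\<^sup>2 * (norm u)\<^sup>2"
      by (simp add: power2_eq_square algebra_simps)
    moreover have "0 \<le> \<kappa>\<^sup>2 * (norm u)\<^sup>2" by simp
    ultimately show ?thesis by linarith
  qed
  then show ?thesis
    using that[of v w] u Hv w vz by (simp add: u_def add.commute)
qed

section \<open>One gradient step near the minima\<close>

lemma hess_uniform_continuity:
  assumes "cball xs R \<subseteq> U" "0 < R" "0 < \<omega>"
  obtains \<eta> where "0 < \<eta>" "\<eta> \<le> R / 4"
    "\<And>p z. p \<in> ball xs (R / 2) \<Longrightarrow> z \<in> ball p \<eta> \<Longrightarrow> norm (H z - H p) \<le> \<omega>"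
proof -
  have "uniformly_continuous_on (cball xs R) H"
    by (intro compact_uniformly_continuous continuous_on_subset[OF cont_H assms(1)]) simp
  then obtain d where d: "0 < d"
    "\<And>y z. y \<in> cball xs R \<Longrightarrow> z \<in> cball xs R \<Longrightarrow> dist z y < d \<Longrightarrow> dist (H z) (H y) < \<omega>"
    using assms(3) by (force simp: uniformly_continuous_on_def)
  show ?thesis
  proof (rule that)
    show "0 < min d (R / 4)" "min d (R / 4) \<le> R / 4" using d assms by auto
    fix p z assume pz: "p \<in> ball xs (R / 2)" "z \<in> ball p (min d (R / 4))"
    then have "dist xs z < R"
      using dist_triangle[of xs z p] assms(2) by simp
    then show "norm (H z - H p) \<le> \<omega>"
      using d(2)[of p z] pz assms(2) by (simp add: dist_commute flip: dist_norm)
  qed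
qed

text \<open>Linearised at \<open>p\<close>, the step leaves the kernel component \<open>v\<close> of
  \<open>x - p\<close> unchanged and contracts the range component \<open>w\<close>. The former
  costs \<open>2 * \<kappa>\<close>, the latter gives the rate. Since \<open>p\<close> varies with
  \<open>x\<close>, the radius \<open>\<eta>\<close> must be uniform in the base point.\<close>

lemma gradient_step_contraction:
  assumes R: "cball xs R \<subseteq> U" "0 < R" and \<sigma>: "0 \<le> \<sigma>" and \<gamma>: "0 < \<gamma>" and \<epsilon>: "0 < \<epsilon>"
  obtains \<eta> where "0 < \<eta>"
    "\<And>x. x \<in> ball xs (R / 4) \<Longrightarrow> infdist x (minima R) < \<eta> \<Longrightarrow>
      \<exists>p\<in>minima R. (norm (x - \<gamma> *\<^sub>R gradient f x - p))\<^sup>2 + \<gamma>\<^sup>2 * \<sigma> * (f x - f xs)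
        \<le> (rate \<mu> L \<sigma> \<gamma> + \<epsilon>) * (infdist x (minima R))\<^sup>2"
proof -
  \<comment> \<open>The product \<open>\<kappa> * C\<close> will bound all linearisation errors,
    once \<open>\<omega> \<le> \<kappa> * (\<mu> / 4)\<close>. In \<open>2 + C\<close> below, the 2
    is the share of the kernel component.\<close>
  define C where "C = 2 * \<gamma> * (\<mu> / 4) * (1 + \<gamma> * L) + \<gamma>\<^sup>2 * (\<mu> / 4)\<^sup>2 + \<gamma>\<^sup>2 * \<sigma> * (\<mu> / 4)"
  have C: "0 \<le> C" using \<sigma> \<gamma> mu_pos mu_le_L by (simp add: C_def)
  define \<kappa> where "\<kappa> = min (1 / 2) (\<epsilon> / (2 + C))"
  have \<kappa>: "0 < \<kappa>" "\<kappa> < 1" using \<epsilon> C by (auto simp: \<kappa>_def)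
  have "\<kappa> \<le> \<epsilon> / (2 + C)" by (simp add: \<kappa>_def)
  then have \<kappa>\<epsilon>: "\<kappa> * (2 + C) \<le> \<epsilon>" using C by (simp add: pos_le_divide_eq)
  \<comment> \<open>This is the oscillation of the Hessian that
    \<open>nearest_minimum_displacement\<close> tolerates.\<close>
  define \<omega> where "\<omega> = \<mu> * \<kappa>\<^sup>2 / 4"
  have \<omega>: "0 < \<omega>" using \<kappa> mu_pos by (simp add: \<omega>_def)
  have \<kappa>2: "\<kappa>\<^sup>2 \<le> \<kappa>" using \<kappa> by (simp add: power2_eq_square mult_left_le_one_le)
  then have "\<mu> * \<kappa>\<^sup>2 \<le> \<mu> * \<kappa>" using mu_pos by (intro mult_left_mono) auto
  then have \<omega>\<kappa>: "\<omega> \<le> \<kappa> * (\<mu> / 4)" by (simp add: \<omega>_def mult_ac)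
  have "(\<kappa> * (\<mu> / 4))\<^sup>2 = \<kappa>\<^sup>2 * (\<mu> / 4)\<^sup>2" by (rule power_mult_distrib)
  also have "\<dots> \<le> \<kappa> * (\<mu> / 4)\<^sup>2" using \<kappa>2 by (intro mult_right_mono) auto
  finally have \<omega>2: "\<omega>\<^sup>2 \<le> \<kappa> * (\<mu> / 4)\<^sup>2"
    using power_mono[OF \<omega>\<kappa>, of 2] \<omega> by linarith
  have err: "2 * \<gamma> * \<omega> * (1 + \<gamma> * L) + \<gamma>\<^sup>2 * \<omega>\<^sup>2 + \<gamma>\<^sup>2 * \<sigma> * \<omega> \<le> \<kappa> * C"
  proof -
    have "2 * \<gamma> * (1 + \<gamma> * L) * \<omega> + \<gamma>\<^sup>2 * \<omega>\<^sup>2 + \<gamma>\<^sup>2 * \<sigma> * \<omega>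
      \<le> 2 * \<gamma> * (1 + \<gamma> * L) * (\<kappa> * (\<mu> / 4)) + \<gamma>\<^sup>2 * (\<kappa> * (\<mu> / 4)\<^sup>2) + \<gamma>\<^sup>2 * \<sigma> * (\<kappa> * (\<mu> / 4))"
      using \<omega>\<kappa> \<omega>2 \<gamma> \<sigma> mu_pos mu_le_L by (intro add_mono mult_left_mono) auto
    then show ?thesis by (simp add: C_def field_simps)
  qed
  obtain \<eta> where \<eta>: "0 < \<eta>" "\<eta> \<le> R / 4"
    and H: "\<And>p z. p \<in> ball xs (R / 2) \<Longrightarrow> z \<in> ball p \<eta> \<Longrightarrow> norm (H z - H p) \<le> \<omega>"
    using hess_uniform_continuity[OF R \<omega>] by blast
  show ?thesis
  proof (rule that[OF \<eta>(1)])
    fix x assume x: "x \<in> ball xs (R / 4)" "infdist x (minima R) < \<eta>"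
    obtain p where p: "p \<in> minima R" "infdist x (minima R) = norm (x - p)"
      "norm (x - p) < R / 4" "p \<in> ball xs (R / 2)"
      using nearest_minimum[OF R x(1)] by blast
    have pU: "p \<in> U" and fp: "f p = f xs" using p R by (auto simp: minima_def)
    have sub: "ball p \<eta> \<subseteq> U"
    proof -
      have "dist xs z < R" if "dist p z < \<eta>" for z
        using dist_triangle[of xs z p] p(4) \<eta> that R by simp
      then show ?thesis using R by (fastforce intro: less_imp_le)
    qed
    define u where "u = x - p"
    define A where "A = blinfun_apply (H p)"
    have "norm (x - p) \<le> norm (x - q)" if "q \<in> minima R" for q
      using infdist_le[OF that, of x] p(2) by (simp add: dist_norm)
    then obtain v w where vw: "u = v + w" "A v = 0" "w \<in> range A" "\<And>z. v \<bullet> A z = 0"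
      "(norm v)\<^sup>2 \<le> 2 * \<kappa> * (norm u)\<^sup>2"
      using nearest_minimum_displacement[OF R p(1,4) _ p(3) _ sub \<kappa> H[OF p(4), unfolded \<omega>_def]]
        x(2) p(2) unfolding A_def u_def by metis
    have linA: "linear A" unfolding A_def by (rule bounded_linear.linear[OF blinfun.bounded_linear_right])
    interpret linear A by (rule linA)
    have Au: "A u = A w" by (simp add: vw add)
    have AL: "norm (A y) \<le> L * norm y" for y
      using hess_lip[OF pU fp] by (simp add: A_def)
    have xb: "x \<in> ball p \<eta>" using x p(2) by (simp add: dist_norm norm_minus_commute)
    define e where "e = gradient f x - A u"
    have e: "norm e \<le> \<omega> * norm u"
      using gradient_linearization[OF sub H[OF p(4)] xb, of p] \<eta>(1) gradient_eq_0[OF pU fp]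
      by (simp add: e_def A_def u_def)
    have fx: "f x - f xs \<le> A w \<bullet> w / 2 + \<omega> * (norm u)\<^sup>2"
    proof -
      have "f x - f xs - A u \<bullet> u / 2 \<le> \<omega> * (norm u)\<^sup>2"
        using second_order_expansion[OF sub H[OF p(4)] _ fp, of u] x(2) p(2)
        by (simp add: A_def u_def)
      moreover have "A u \<bullet> u = A w \<bullet> w"
        using vw(4)[of w] unfolding Au by (simp add: vw(1) inner_add inner_commute)
      ultimately show ?thesis by simp
    qed
    define a where "a = u - \<gamma> *\<^sub>R A u"
    have a2: "(norm a)\<^sup>2 = (norm v)\<^sup>2 + (norm (w - \<gamma> *\<^sub>R A w))\<^sup>2"
    proof -
      have "v \<bullet> (w - \<gamma> *\<^sub>R A w) = 0" using vw(3,4) by (auto simp: inner_diff)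
      moreover have "a = v + (w - \<gamma> *\<^sub>R A w)" unfolding a_def Au by (simp add: vw(1))
      ultimately show ?thesis
        by (simp only: power2_norm_eq_inner inner_add inner_commute[of "w - \<gamma> *\<^sub>R A w" v])
    qed
    have a1: "norm a \<le> (1 + \<gamma> * L) * norm u"
    proof -
      have "norm a \<le> norm u + \<gamma> * norm (A u)"
        using norm_triangle_ineq4[of u "\<gamma> *\<^sub>R A u"] \<gamma> by (simp add: a_def)
      also have "\<gamma> * norm (A u) \<le> \<gamma> * (L * norm u)"
        using AL[of u] \<gamma> by (intro mult_left_mono) auto
      finally show ?thesis by (simp add: algebra_simps)
    qed
    have nw: "(norm w)\<^sup>2 \<le> (norm u)\<^sup>2"
    proof -
      have "v \<bullet> w = 0" using vw(3,4) by auto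
      then have "(norm u)\<^sup>2 = (norm v)\<^sup>2 + (norm w)\<^sup>2"
        unfolding vw(1) power2_norm_eq_inner by (simp add: inner_add inner_commute)
      then show ?thesis by simp
    qed
    have "(norm (x - \<gamma> *\<^sub>R gradient f x - p))\<^sup>2 = (norm (a - \<gamma> *\<^sub>R e))\<^sup>2"
      by (simp add: a_def e_def u_def algebra_simps)
    also have "\<dots> \<le> (norm a + \<gamma> * norm e)\<^sup>2"
      using norm_triangle_ineq4[of a "\<gamma> *\<^sub>R e"] \<gamma> by (intro power_mono) auto
    also have "\<dots> = (norm a)\<^sup>2 + 2 * \<gamma> * (norm a * norm e) + \<gamma>\<^sup>2 * (norm e)\<^sup>2"
      by (simp add: power2_eq_square algebra_simps)
    also have "\<dots> \<le> (norm a)\<^sup>2 + 2 * \<gamma> * (((1 + \<gamma> * L) * norm u) * (\<omega> * norm u)) + \<gamma>\<^sup>2 * (\<omega> * norm u)\<^sup>2"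
      using \<gamma> a1 e mu_pos mu_le_L
      by (intro add_mono mult_left_mono mult_mono power_mono order_refl) auto
    finally have 1: "(norm (x - \<gamma> *\<^sub>R gradient f x - p))\<^sup>2
      \<le> (norm a)\<^sup>2 + (2 * \<gamma> * \<omega> * (1 + \<gamma> * L) + \<gamma>\<^sup>2 * \<omega>\<^sup>2) * (norm u)\<^sup>2"
      by (simp add: power2_eq_square algebra_simps)
    have "\<gamma>\<^sup>2 * \<sigma> * (f x - f xs) \<le> \<gamma>\<^sup>2 * \<sigma> * (A w \<bullet> w / 2 + \<omega> * (norm u)\<^sup>2)"
      using fx \<sigma> by (intro mult_left_mono) auto
    then have 2: "\<gamma>\<^sup>2 * \<sigma> * (f x - f xs) \<le> \<gamma>\<^sup>2 * \<sigma> / 2 * (A w \<bullet> w) + \<gamma>\<^sup>2 * \<sigma> * \<omega> * (norm u)\<^sup>2"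
      by (simp add: algebra_simps)
    have "(norm (w - \<gamma> *\<^sub>R A w))\<^sup>2 + \<gamma>\<^sup>2 * \<sigma> / 2 * (A w \<bullet> w) \<le> rate \<mu> L \<sigma> \<gamma> * (norm w)\<^sup>2"
    proof (rule gradient_step_contraction_linear[OF linA _ _ _ AL mu_pos mu_le_L vw(3)])
      show "A x \<bullet> y = x \<bullet> A y" "0 \<le> A x \<bullet> x" "\<mu> * (A x \<bullet> x) \<le> (norm (A x))\<^sup>2" for x y
        unfolding A_def by (rule hess_symmetric[OF pU] hess_psd[OF pU fp] hess_pl[OF pU fp])+
    qed
    also have "\<dots> \<le> rate \<mu> L \<sigma> \<gamma> * (norm u)\<^sup>2"
      using nw rate_nonneg[OF mu_pos \<sigma>] by (intro mult_left_mono) auto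
    finally have 3: "(norm (w - \<gamma> *\<^sub>R A w))\<^sup>2 + \<gamma>\<^sup>2 * \<sigma> / 2 * (A w \<bullet> w) \<le> rate \<mu> L \<sigma> \<gamma> * (norm u)\<^sup>2" .
    have "(2 * \<gamma> * \<omega> * (1 + \<gamma> * L) + \<gamma>\<^sup>2 * \<omega>\<^sup>2 + \<gamma>\<^sup>2 * \<sigma> * \<omega>) * (norm u)\<^sup>2 \<le> \<kappa> * C * (norm u)\<^sup>2"
      by (rule mult_right_mono[OF err]) simp
    then have 4: "(2 * \<gamma> * \<omega> * (1 + \<gamma> * L) + \<gamma>\<^sup>2 * \<omega>\<^sup>2) * (norm u)\<^sup>2 + \<gamma>\<^sup>2 * \<sigma> * \<omega> * (norm u)\<^sup>2
      \<le> \<kappa> * C * (norm u)\<^sup>2"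
      by (simp add: algebra_simps)
    have "\<kappa> * (2 + C) * (norm u)\<^sup>2 \<le> \<epsilon> * (norm u)\<^sup>2"
      by (rule mult_right_mono[OF \<kappa>\<epsilon>]) simp
    then have 5: "2 * \<kappa> * (norm u)\<^sup>2 + \<kappa> * C * (norm u)\<^sup>2 \<le> \<epsilon> * (norm u)\<^sup>2"
      by (simp add: algebra_simps)
    have "(norm (x - \<gamma> *\<^sub>R gradient f x - p))\<^sup>2 + \<gamma>\<^sup>2 * \<sigma> * (f x - f xs)
      \<le> rate \<mu> L \<sigma> \<gamma> * (norm u)\<^sup>2 + \<epsilon> * (norm u)\<^sup>2"
      using 1 2 3 4 5 a2 vw(5) by linarith
    then show "\<exists>p\<in>minima R. (norm (x - \<gamma> *\<^sub>R gradient f x - p))\<^sup>2 + \<gamma>\<^sup>2 * \<sigma> * (f x - f xs)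
        \<le> (rate \<mu> L \<sigma> \<gamma> + \<epsilon>) * (infdist x (minima R))\<^sup>2"
      using p(1,2) by (intro bexI[of _ p]) (auto simp: u_def distrib_right)
  qed
qed

end

section \<open>Geometric decay and the noise\<close>

lemma dist_le_geometric_steps:
  fixes x :: "nat \<Rightarrow> 'a::real_normed_vector"
  assumes "\<And>j. j < m \<Longrightarrow> norm (x (Suc j) - x j) \<le> c * s ^ j" and s: "s < 1"
  shows "norm (x m - x 0) \<le> c * (1 - s ^ m) / (1 - s)"
  using assms(1)
proof (induction m)
  case (Suc m)
  have "norm (x (Suc m) - x 0) \<le> norm (x (Suc m) - x m) + norm (x m - x 0)"
    using norm_triangle_ineq[of "x (Suc m) - x m" "x m - x 0"] by simp
  also have "\<dots> \<le> c * s ^ m + c * (1 - s ^ m) / (1 - s)"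
    by (intro add_mono Suc.IH Suc.prems) auto
  also have "\<dots> = c * (1 - s ^ Suc m) / (1 - s)"
    using s by (simp add: field_simps)
  finally show ?case .
qed simp

text \<open>The increments are summed with ratio \<open>sqrt t\<close>, and squaring the tail
  restores the ratio \<open>t\<close>: the squared distance to the limit inherits the rate of the
  squared increments without loss.\<close>

lemma geometric_steps_converge:
  fixes x :: "nat \<Rightarrow> 'a::banach"
  assumes t: "0 < t" "t < 1" and step: "\<And>k. (norm (x (Suc k) - x k))\<^sup>2 \<le> K * t ^ k"
  obtains l K' where "x \<longlonglongrightarrow> l" "\<And>k. (norm (x k - l))\<^sup>2 \<le> K' * t ^ k"
proof -
  define s where "s = sqrt t"
  have s: "0 < s" "s < 1" "s\<^sup>2 = t" using t by (auto simp: s_def)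
  have "0 \<le> (norm (x (Suc 0) - x 0))\<^sup>2" by simp
  also have "\<dots> \<le> K" using step[of 0] by simp
  finally have K: "0 \<le> K" .
  define c where "c = sqrt K / (1 - s)"
  have c: "0 \<le> c" using K s by (simp add: c_def)
  have step': "norm (x (Suc k) - x k) \<le> sqrt K * s ^ k" for k
  proof (rule power2_le_imp_le)
    show "(norm (x (Suc k) - x k))\<^sup>2 \<le> (sqrt K * s ^ k)\<^sup>2"
      using step[of k] K
      by (simp add: power_mult_distrib s(3)[symmetric] power_commutes flip: power_mult power_even_eq)
        (simp add: mult.commute)
  qed (use K s in auto)
  have tail: "norm (x (k + m) - x k) \<le> c * s ^ k" for k m
  proof -
    have "norm (x (k + m) - x (k + 0)) \<le> (sqrt K * s ^ k) * (1 - s ^ m) / (1 - s)"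
      using step'[of "k + _"] s(2)
      by (intro dist_le_geometric_steps[of m "\<lambda>j. x (k + j)"]) (auto simp: power_add mult_ac)
    also have "\<dots> \<le> (sqrt K * s ^ k) * 1 / (1 - s)"
      using s K by (intro divide_right_mono mult_left_mono) auto
    finally show ?thesis by (simp add: c_def)
  qed
  have lim0: "(\<lambda>k. c * s ^ k) \<longlonglongrightarrow> 0"
    using s by (intro tendsto_mult_right_zero LIMSEQ_power_zero) auto
  have "Cauchy x"
  proof (rule CauchyI')
    fix e :: real assume "0 < e"
    from order_tendstoD(2)[OF lim0 this] obtain N where N: "\<And>k. N \<le> k \<Longrightarrow> c * s ^ k < e"
      by (auto simp: eventually_sequentially)
    show "\<exists>M. \<forall>m\<ge>M. \<forall>n>m. dist (x m) (x n) < e"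
    proof (intro exI allI impI)
      fix m n assume mn: "N \<le> m" "m < n"
      then show "dist (x m) (x n) < e"
        unfolding dist_norm using tail[of m "n - m"] N[of m] by (simp add: norm_minus_commute)
    qed
  qed
  then obtain l where l: "x \<longlonglongrightarrow> l" by (auto simp: convergent_eq_Cauchy[symmetric] convergent_def)
  have "(norm (x k - l))\<^sup>2 \<le> c\<^sup>2 * t ^ k" for k
  proof -
    have "(\<lambda>m. norm (x (m + k) - x k)) \<longlonglongrightarrow> norm (l - x k)"
      by (intro tendsto_intros LIMSEQ_ignore_initial_segment l)
    then have "norm (l - x k) \<le> c * s ^ k"
      by (rule tendsto_upperbound) (auto intro!: always_eventually simp: add.commute[of _ k] tail)
    then have "(norm (x k - l))\<^sup>2 \<le> (c * s ^ k)\<^sup>2"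
      by (intro power_mono) (auto simp: norm_minus_commute)
    then show ?thesis
      by (simp add: power_mult_distrib s(3)[symmetric] mult.commute flip: power_mult)
  qed
  with l show ?thesis by (rule that)
qed

text \<open>The sum of the \<open>X k / t ^ k\<close> restricted to \<open>G k\<close> has finite
  expectation because \<open>r / t < 1\<close>; it is thus finite almost everywhere and bounds each
  of its terms. The gap between \<open>r\<close> and \<open>t\<close> is the price of a pathwise
  bound.\<close>

lemma AE_geometric_bound:
  fixes X :: "nat \<Rightarrow> 'a \<Rightarrow> real" and C :: ennreal
  assumes [measurable]: "\<And>k. X k \<in> borel_measurable M" "\<And>k. G k \<in> sets M"
    and bound: "\<And>k. (\<integral>\<^sup>+\<omega>\<in>G k. ennreal (X k \<omega>) \<partial>M) \<le> ennreal (r ^ k) * C"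
    and C: "C < \<infinity>" and r: "0 \<le> r" "r < t"
  shows "AE \<omega> in M. (\<forall>k. \<omega> \<in> G k) \<longrightarrow> (\<exists>K. \<forall>k. X k \<omega> \<le> K * t ^ k)"
proof -
  have t: "0 < t" using r by simp
  define Z where "Z k \<omega> = ennreal (1 / t ^ k) * (ennreal (X k \<omega>) * indicator (G k) \<omega>)" for k \<omega>
  have [measurable]: "Z k \<in> borel_measurable M" for k unfolding Z_def by measurable
  have "(\<integral>\<^sup>+\<omega>. (\<Sum>k. Z k \<omega>) \<partial>M) = (\<Sum>k. \<integral>\<^sup>+\<omega>. Z k \<omega> \<partial>M)"
    by (rule nn_integral_suminf) simp
  also have "\<dots> \<le> (\<Sum>k. ennreal ((r / t) ^ k) * C)"
  proof (intro suminf_le allI)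
    fix k
    have "(\<integral>\<^sup>+\<omega>. Z k \<omega> \<partial>M) = ennreal (1 / t ^ k) * (\<integral>\<^sup>+\<omega>\<in>G k. ennreal (X k \<omega>) \<partial>M)"
      unfolding Z_def by (rule nn_integral_cmult) measurable
    also have "\<dots> \<le> ennreal (1 / t ^ k) * (ennreal (r ^ k) * C)"
      by (intro mult_left_mono bound) simp
    also have "\<dots> = ennreal ((r / t) ^ k) * C"
      using r t by (simp add: power_divide mult.assoc[symmetric] flip: ennreal_mult)
    finally show "(\<integral>\<^sup>+\<omega>. Z k \<omega> \<partial>M) \<le> ennreal ((r / t) ^ k) * C" .
  qed auto
  also have "\<dots> = ennreal (\<Sum>k. (r / t) ^ k) * C"
    using r t by (simp add: suminf_ennreal_eq[OF _ summable_sums] summable_geometric)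
  also have "\<dots> < \<infinity>" using C by (simp add: ennreal_mult_less_top)
  finally have "(\<integral>\<^sup>+\<omega>. (\<Sum>k. Z k \<omega>) \<partial>M) \<noteq> \<infinity>" by simp
  then have "AE \<omega> in M. (\<Sum>k. Z k \<omega>) \<noteq> \<infinity>"
    by (intro nn_integral_PInf_AE) auto
  then show ?thesis
  proof (rule AE_mp, intro AE_I2 impI)
    fix \<omega> assume fin: "(\<Sum>k. Z k \<omega>) \<noteq> \<infinity>" and G: "\<forall>k. \<omega> \<in> G k"
    define K where "K = enn2real (\<Sum>k. Z k \<omega>)"
    have K: "(\<Sum>k. Z k \<omega>) = ennreal K" "0 \<le> K" using fin by (auto simp: K_def less_top)
    have "X k \<omega> \<le> K * t ^ k" for k
    proof -
      have "Z k \<omega> \<le> ennreal K"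
        unfolding K(1)[symmetric] using sum_le_suminf[of "\<lambda>k. Z k \<omega>" "{k}"] by simp
      then have "ennreal (X k \<omega> / t ^ k) \<le> ennreal K"
        using G t by (simp add: Z_def flip: ennreal_mult')
      then show ?thesis using K t by (simp add: ennreal_le_iff divide_le_eq)
    qed
    then show "\<exists>K. \<forall>k. X k \<omega> \<le> K * t ^ k" by blast
  qed
qed

section \<open>Mean square of one noisy step\<close>

context prob_space
begin

text \<open>The cross term vanishes since \<open>D\<close> is centred given \<open>G\<close> and
  \<open>Y\<close> is known. All is localised to \<open>A\<close>, where the second moment of
  \<open>D\<close> is finite because its conditional version is bounded by \<open>h\<close> and
  \<open>h\<close> is bounded.\<close>

lemma second_moment_noise_step:
  fixes D Y :: "'a \<Rightarrow> 'v::euclidean_space"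
  assumes sub: "subalgebra M G" and A: "A \<in> sets G"
    and Y: "Y \<in> borel_measurable G" and D: "integrable M D" and h: "h \<in> borel_measurable G"
    and Y_bound: "\<And>\<omega>. \<omega> \<in> A \<Longrightarrow> norm (Y \<omega>) \<le> K"
    and h_bound: "\<And>\<omega>. \<omega> \<in> A \<Longrightarrow> 0 \<le> h \<omega> \<and> h \<omega> \<le> K'"
    and mean: "AE \<omega> in M. vec_cond_exp M G D \<omega> = 0"
    and var: "AE \<omega> in M. \<omega> \<in> A \<longrightarrow>
      nn_cond_exp M G (\<lambda>\<omega>. ennreal ((norm (D \<omega>))\<^sup>2)) \<omega> \<le> ennreal (h \<omega>)"
  shows "(\<integral>\<^sup>+\<omega>\<in>A. ennreal ((norm (Y \<omega> - c *\<^sub>R D \<omega>))\<^sup>2) \<partial>M)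
    \<le> (\<integral>\<^sup>+\<omega>\<in>A. ennreal ((norm (Y \<omega>))\<^sup>2 + c\<^sup>2 * h \<omega>) \<partial>M)"
proof -
  interpret finite_measure_subalgebra M G by unfold_locales (rule sub)
  have [measurable]: "Y \<in> borel_measurable M" "h \<in> borel_measurable M" "D \<in> borel_measurable M"
    using measurable_from_subalg[OF sub Y] measurable_from_subalg[OF sub h] D by auto
  have AM [measurable]: "A \<in> sets M" using A sub by (auto simp: subalgebra_def)
  note [measurable] = A Y h
  \<comment> \<open>Multiplication by a \<open>G\<close>-measurable indicator, instead of
    restriction of the measure, keeps the defining property of conditional expectation
    applicable.\<close>
  define I where "I = (indicator A :: 'a \<Rightarrow> real)"
  have I [measurable]: "I \<in> borel_measurable G" "I \<in> borel_measurable M" by (auto simp: I_def)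
  have set_nn: "(\<integral>\<^sup>+\<omega>\<in>A. ennreal (g \<omega>) \<partial>M) = (\<integral>\<^sup>+\<omega>. ennreal (I \<omega> * g \<omega>) \<partial>M)" for g
    by (intro nn_integral_cong) (auto simp: I_def split: split_indicator)
  have Ih: "integrable M (\<lambda>\<omega>. I \<omega> * h \<omega>)"
    by (rule integrable_const_bound[of _ "max 0 K'"]) (use h_bound in \<open>auto simp: I_def le_max_iff_disj intro!: AE_I2 split: split_indicator\<close>)
  have IY: "integrable M (\<lambda>\<omega>. I \<omega> * (norm (Y \<omega>))\<^sup>2)"
    by (rule integrable_const_bound[of _ "K\<^sup>2"])
      (use Y_bound in \<open>auto simp: I_def split: split_indicator intro!: AE_I2 power_mono\<close>)
  have D2_le: "(\<integral>\<^sup>+\<omega>. ennreal (I \<omega> * (norm (D \<omega>))\<^sup>2) \<partial>M) \<le> (\<integral>\<^sup>+\<omega>. ennreal (I \<omega> * h \<omega>) \<partial>M)"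
  proof -
    have "(\<integral>\<^sup>+\<omega>. ennreal (I \<omega> * (norm (D \<omega>))\<^sup>2) \<partial>M)
        = (\<integral>\<^sup>+\<omega>. indicator A \<omega> * ennreal ((norm (D \<omega>))\<^sup>2) \<partial>M)"
      by (intro nn_integral_cong) (auto simp: I_def split: split_indicator)
    also have "\<dots> = (\<integral>\<^sup>+\<omega>. indicator A \<omega> * nn_cond_exp M G (\<lambda>\<omega>. ennreal ((norm (D \<omega>))\<^sup>2)) \<omega> \<partial>M)"
      by (rule nn_cond_exp_intg[symmetric]) measurable
    also have "\<dots> \<le> (\<integral>\<^sup>+\<omega>. ennreal (I \<omega> * h \<omega>) \<partial>M)"
      by (intro nn_integral_mono_AE, use var in eventually_elim)
        (auto simp: I_def split: split_indicator)
    finally show ?thesis .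
  qed
  also have "\<dots> = ennreal (\<integral>\<omega>. I \<omega> * h \<omega> \<partial>M)"
    by (intro nn_integral_eq_integral Ih AE_I2) (use h_bound in \<open>auto simp: I_def split: split_indicator\<close>)
  finally have D2_fin: "(\<integral>\<^sup>+\<omega>. ennreal (I \<omega> * (norm (D \<omega>))\<^sup>2) \<partial>M) \<le> ennreal (\<integral>\<omega>. I \<omega> * h \<omega> \<partial>M)" .
  have ID: "integrable M (\<lambda>\<omega>. I \<omega> * (norm (D \<omega>))\<^sup>2)"
  proof (rule integrableI_nonneg)
    show "(\<integral>\<^sup>+\<omega>. ennreal (I \<omega> * (norm (D \<omega>))\<^sup>2) \<partial>M) < \<infinity>"
      using D2_fin by (rule le_less_trans) simp
  qed (auto simp: I_def)
  have ID_le: "(\<integral>\<omega>. I \<omega> * (norm (D \<omega>))\<^sup>2 \<partial>M) \<le> (\<integral>\<omega>. I \<omega> * h \<omega> \<partial>M)"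
  proof -
    have "ennreal (\<integral>\<omega>. I \<omega> * (norm (D \<omega>))\<^sup>2 \<partial>M) \<le> ennreal (\<integral>\<omega>. I \<omega> * h \<omega> \<partial>M)"
      using D2_fin by (subst nn_integral_eq_integral[symmetric, OF ID]) (auto simp: I_def)
    moreover have "0 \<le> (\<integral>\<omega>. I \<omega> * h \<omega> \<partial>M)"
      by (rule integral_nonneg_AE) (use h_bound in \<open>auto simp: I_def split: split_indicator\<close>)
    ultimately show ?thesis by (simp add: ennreal_le_iff)
  qed
  \<comment> \<open>Boundedness of \<open>Y\<close> on \<open>A\<close> and plain integrability of
    \<open>D\<close> give this; coordinates are separated to match
    \<open>vec_cond_exp\<close>.\<close>
  have Ib: "integrable M (\<lambda>\<omega>. (I \<omega> * (Y \<omega> \<bullet> b)) * (D \<omega> \<bullet> b))" if b: "b \<in> Basis" for b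
  proof (rule Bochner_Integration.integrable_bound)
    show "integrable M (\<lambda>\<omega>. K * norm (D \<omega>))" using D by simp
    show "AE \<omega> in M. norm ((I \<omega> * (Y \<omega> \<bullet> b)) * (D \<omega> \<bullet> b)) \<le> norm (K * norm (D \<omega>))"
    proof (rule AE_I2)
      fix \<omega>
      show "norm ((I \<omega> * (Y \<omega> \<bullet> b)) * (D \<omega> \<bullet> b)) \<le> norm (K * norm (D \<omega>))"
      proof (cases "\<omega> \<in> A")
        case True
        have "\<bar>Y \<omega> \<bullet> b\<bar> \<le> K" using Basis_le_norm[OF b, of "Y \<omega>"] Y_bound[OF True] by simp
        then show ?thesis
          using True Basis_le_norm[OF b, of "D \<omega>"] by (auto simp: I_def abs_mult intro!: mult_mono)
      qed (simp add: I_def)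
    qed
  qed measurable
  have Ib0: "(\<integral>\<omega>. (I \<omega> * (Y \<omega> \<bullet> b)) * (D \<omega> \<bullet> b) \<partial>M) = 0" if b: "b \<in> Basis" for b
  proof -
    have "(\<integral>\<omega>. (I \<omega> * (Y \<omega> \<bullet> b)) * (D \<omega> \<bullet> b) \<partial>M)
      = (\<integral>\<omega>. (I \<omega> * (Y \<omega> \<bullet> b)) * real_cond_exp M G (\<lambda>\<omega>. D \<omega> \<bullet> b) \<omega> \<partial>M)"
      by (rule real_cond_exp_intg(2)[symmetric]) (use Ib[OF b] in measurable)
    also have "\<dots> = (\<integral>\<omega>. 0 \<partial>M)"
    proof (rule integral_cong_AE)
      show "AE \<omega> in M. (I \<omega> * (Y \<omega> \<bullet> b)) * real_cond_exp M G (\<lambda>\<omega>. D \<omega> \<bullet> b) \<omega> = 0"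
        using mean
      proof eventually_elim
        case (elim \<omega>)
        then have "vec_cond_exp M G D \<omega> \<bullet> b = 0" by simp
        then show ?case using b by (simp add: vec_cond_exp_def inner_sum_left inner_Basis if_distrib cong: if_cong)
      qed
    qed measurable
    finally show ?thesis by simp
  qed
  have YD: "I \<omega> * (Y \<omega> \<bullet> D \<omega>) = (\<Sum>b\<in>Basis. (I \<omega> * (Y \<omega> \<bullet> b)) * (D \<omega> \<bullet> b))" for \<omega>
    by (subst euclidean_inner) (simp add: sum_distrib_left mult.assoc)
  have IYD: "integrable M (\<lambda>\<omega>. I \<omega> * (Y \<omega> \<bullet> D \<omega>))" "(\<integral>\<omega>. I \<omega> * (Y \<omega> \<bullet> D \<omega>) \<partial>M) = 0"
    unfolding YD using Ib Ib0 by (auto simp: Bochner_Integration.integral_sum)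
  have expand: "I \<omega> * (norm (Y \<omega> - c *\<^sub>R D \<omega>))\<^sup>2
    = I \<omega> * (norm (Y \<omega>))\<^sup>2 - 2 * c * (I \<omega> * (Y \<omega> \<bullet> D \<omega>)) + c\<^sup>2 * (I \<omega> * (norm (D \<omega>))\<^sup>2)" for \<omega>
    unfolding norm_diff_scaleR_square by (simp add: algebra_simps)
  have "(\<integral>\<^sup>+\<omega>\<in>A. ennreal ((norm (Y \<omega> - c *\<^sub>R D \<omega>))\<^sup>2) \<partial>M)
      = ennreal (\<integral>\<omega>. I \<omega> * (norm (Y \<omega> - c *\<^sub>R D \<omega>))\<^sup>2 \<partial>M)"
    unfolding set_nn
  proof (rule nn_integral_eq_integral)
    show "integrable M (\<lambda>\<omega>. I \<omega> * (norm (Y \<omega> - c *\<^sub>R D \<omega>))\<^sup>2)"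
      unfolding expand using IY IYD ID by auto
  qed (auto simp: I_def)
  also have "(\<integral>\<omega>. I \<omega> * (norm (Y \<omega> - c *\<^sub>R D \<omega>))\<^sup>2 \<partial>M)
      = (\<integral>\<omega>. I \<omega> * (norm (Y \<omega>))\<^sup>2 \<partial>M) + c\<^sup>2 * (\<integral>\<omega>. I \<omega> * (norm (D \<omega>))\<^sup>2 \<partial>M)"
    unfolding expand using IY IYD ID by simp
  also have "\<dots> \<le> (\<integral>\<omega>. I \<omega> * (norm (Y \<omega>))\<^sup>2 \<partial>M) + c\<^sup>2 * (\<integral>\<omega>. I \<omega> * h \<omega> \<partial>M)"
    using ID_le by (intro add_left_mono mult_left_mono) auto
  also have "\<dots> = (\<integral>\<omega>. I \<omega> * ((norm (Y \<omega>))\<^sup>2 + c\<^sup>2 * h \<omega>) \<partial>M)"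
    using IY Ih by (simp add: distrib_left mult.left_commute[of _ "c\<^sup>2"])
  also have "ennreal \<dots> = (\<integral>\<^sup>+\<omega>. ennreal (I \<omega> * ((norm (Y \<omega>))\<^sup>2 + c\<^sup>2 * h \<omega>)) \<partial>M)"
  proof (rule nn_integral_eq_integral[symmetric])
    show "integrable M (\<lambda>\<omega>. I \<omega> * ((norm (Y \<omega>))\<^sup>2 + c\<^sup>2 * h \<omega>))"
      using IY Ih by (simp add: distrib_left mult.left_commute[of _ "c\<^sup>2"])
  qed (use h_bound in \<open>auto simp: I_def split: split_indicator\<close>)
  finally show ?thesis by (simp add: set_nn ennreal_leI)
qed

end

section \<open>Expected distance to the minima\<close>

locale sgd_near_minimum = pl_region f H U xs \<mu> L + prob_space M
  for f :: "'v::euclidean_space \<Rightarrow> real" and H :: "'v \<Rightarrow> 'v \<Rightarrow>\<^sub>L 'v" and U xs \<mu> L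
    and M :: "'\<omega> measure" +
  fixes F :: "nat \<Rightarrow> '\<omega> measure" and \<theta> D :: "nat \<Rightarrow> '\<omega> \<Rightarrow> 'v" and \<gamma> \<sigma> R :: real
  assumes filtration: "filtration (space M) F"
    and subalg: "subalgebra M (F k)"
    and C1: "continuously_differentiable_on UNIV f"
    and sgd: "sgd_scheme M F f \<gamma> \<theta> D"
    and sigma_nonneg: "0 \<le> \<sigma>"
    and noise: "1 \<le> k \<Longrightarrow> AE \<omega> in M. \<theta> (k - 1) \<omega> \<in> U \<longrightarrow>
      nn_cond_exp M (F (k - 1)) (\<lambda>\<omega>. ennreal ((norm (D k \<omega>))\<^sup>2)) \<omega>
        \<le> ennreal (\<sigma> * (f (\<theta> (k - 1) \<omega>) - f xs))"
    and R: "0 < R" "cball xs R \<subseteq> U"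
begin

section \<open>Measurability of the scheme\<close>

lemma gamma_pos: "0 < \<gamma>"
  using sgd by (simp add: sgd_scheme_def)

lemma sets_F: "A \<in> sets (F k) \<Longrightarrow> A \<in> sets M"
  using subalg[of k] by (auto simp: subalgebra_def)

lemma theta_adapted: "j \<le> k \<Longrightarrow> \<theta> j \<in> borel_measurable (F k)"
proof -
  assume "j \<le> k"
  then have "sets (F j) \<subseteq> sets (F k)" "space (F j) = space (F k)"
    using filtration by (auto simp: filtration_def)
  moreover have "\<theta> j \<in> borel_measurable (F j)" using sgd by (simp add: sgd_scheme_def)
  ultimately show ?thesis
    by (metis measurable_from_subalg subalgebra_def)
qed

lemma theta_measurable [measurable]: "\<theta> k \<in> borel_measurable M"
  using measurable_from_subalg[OF subalg theta_adapted[OF order_refl]] .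

lemma pred_theta_F: "B \<in> sets borel \<Longrightarrow> j \<le> k \<Longrightarrow> {\<omega> \<in> space M. \<theta> j \<omega> \<in> B} \<in> sets (F k)"
  using measurable_sets[OF theta_adapted, of j k B] filtration
  by (simp add: filtration_def vimage_def Int_def conj_commute)

lemma D_integrable: "integrable M (D (Suc k))"
  using sgd by (simp add: sgd_scheme_def)

lemma theta_Suc:
  "AE \<omega> in M. \<theta> (Suc k) \<omega> = \<theta> k \<omega> - \<gamma> *\<^sub>R (gradient f (\<theta> k \<omega>) + D (Suc k) \<omega>)"
proof -
  have "1 \<le> Suc k" by simp
  then have "AE \<omega> in M. \<theta> (Suc k) \<omega> =
      \<theta> (Suc k - 1) \<omega> - \<gamma> *\<^sub>R (gradient f (\<theta> (Suc k - 1) \<omega>) + D (Suc k) \<omega>)"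
    using sgd unfolding sgd_scheme_def by blast
  then show ?thesis by simp
qed

lemma continuous_gradient: "continuous_on UNIV (gradient f)"
  using C1 by (simp add: continuously_differentiable_on_def)

lemma continuous_f: "continuous_on UNIV f"
  using C1 by (auto simp: continuously_differentiable_on_def
      intro!: continuous_at_imp_continuous_on differentiable_imp_continuous_within)

lemma gradient_measurable [measurable]: "gradient f \<in> borel_measurable borel"
  by (rule borel_measurable_continuous_onI[OF continuous_gradient])

lemma f_measurable [measurable]: "f \<in> borel_measurable borel"
  by (rule borel_measurable_continuous_onI[OF continuous_f])

text \<open>The distance to the whole set, unlike that to a selected nearest point, is continuous
  and hence measurable.\<close>

definition dev :: "'v \<Rightarrow> real" where
  "dev x = (infdist x (minima R))\<^sup>2"

lemma dev_nonneg [simp]: "0 \<le> dev x"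
  by (simp add: dev_def)

lemma infdist_measurable [measurable]: "(\<lambda>x. infdist x (minima R)) \<in> borel_measurable borel"
  by (intro borel_measurable_continuous_onI continuous_on_infdist continuous_on_id)

lemma dev_measurable [measurable]: "dev \<in> borel_measurable borel"
  unfolding dev_def[abs_def] by measurable

lemma dev_le: "p \<in> minima R \<Longrightarrow> dev x \<le> (norm (x - p))\<^sup>2"
  unfolding dev_def dist_norm[symmetric]
  by (intro power_mono infdist_le infdist_nonneg)

text \<open>The map \<open>g\<close> is left open to serve twice: minus a fixed minimum after a
  gradient step for deviations, and as the bare drift for increments. Compactness of the ball
  supplies the bounds.\<close>

lemma noise_step:
  assumes A: "A \<in> sets (F k)" and \<theta>: "\<And>\<omega>. \<omega> \<in> A \<Longrightarrow> \<theta> k \<omega> \<in> cball xs R"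
    and g: "continuous_on UNIV (g :: 'v \<Rightarrow> 'v)"
  shows "(\<integral>\<^sup>+\<omega>\<in>A. ennreal ((norm (g (\<theta> k \<omega>) - \<gamma> *\<^sub>R D (Suc k) \<omega>))\<^sup>2) \<partial>M)
    \<le> (\<integral>\<^sup>+\<omega>\<in>A. ennreal ((norm (g (\<theta> k \<omega>)))\<^sup>2 + \<gamma>\<^sup>2 * (\<sigma> * (f (\<theta> k \<omega>) - f xs))) \<partial>M)"
proof -
  have "compact (g ` cball xs R)"
    by (intro compact_continuous_image continuous_on_subset[OF g]) auto
  then obtain K where K: "\<And>x. x \<in> cball xs R \<Longrightarrow> norm (g x) \<le> K"
    using compact_imp_bounded bounded_iff by (metis imageI)
  have "compact (f ` cball xs R)"
    by (intro compact_continuous_image continuous_on_subset[OF continuous_f]) auto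
  then obtain K' where K': "\<And>x. x \<in> cball xs R \<Longrightarrow> norm (f x) \<le> K'"
    using compact_imp_bounded bounded_iff by (metis imageI)
  have [measurable]: "\<theta> k \<in> borel_measurable (F k)" by (rule theta_adapted) simp
  have [measurable]: "g \<in> borel_measurable borel" by (rule borel_measurable_continuous_onI[OF g])
  show ?thesis
  proof (rule second_moment_noise_step[OF subalg A _ D_integrable])
    show "(\<lambda>\<omega>. g (\<theta> k \<omega>)) \<in> borel_measurable (F k)" by measurable
    show "(\<lambda>\<omega>. \<sigma> * (f (\<theta> k \<omega>) - f xs)) \<in> borel_measurable (F k)" by measurable
    show "norm (g (\<theta> k \<omega>)) \<le> K" if "\<omega> \<in> A" for \<omega> using K \<theta>[OF that] by auto
    show "0 \<le> \<sigma> * (f (\<theta> k \<omega>) - f xs) \<and> \<sigma> * (f (\<theta> k \<omega>) - f xs) \<le> \<sigma> * (K' - f xs)"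
      if "\<omega> \<in> A" for \<omega>
      using K'[OF \<theta>[OF that]] minimal[of "\<theta> k \<omega>"] \<theta>[OF that] R sigma_nonneg
      by (auto intro!: mult_nonneg_nonneg mult_left_mono)
    have "1 \<le> Suc k" by simp
    then have "AE \<omega> in M. vec_cond_exp M (F (Suc k - 1)) (D (Suc k)) \<omega> = 0"
      using sgd unfolding sgd_scheme_def by blast
    then show "AE \<omega> in M. vec_cond_exp M (F k) (D (Suc k)) \<omega> = 0" by simp
    show "AE \<omega> in M. \<omega> \<in> A \<longrightarrow> nn_cond_exp M (F k) (\<lambda>\<omega>. ennreal ((norm (D (Suc k) \<omega>))\<^sup>2)) \<omega>
        \<le> ennreal (\<sigma> * (f (\<theta> k \<omega>) - f xs))"
      using noise[OF \<open>1 \<le> Suc k\<close>]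
    proof eventually_elim
      case (elim \<omega>)
      then show ?case using \<theta>[of \<omega>] R by auto
    qed
  qed
qed

text \<open>Separated out because the path estimates are used twice: with some factor below 1 on a
  ball, to confine the path, and with a factor close to the rate near the minima, for the
  speed.\<close>

definition contracting :: "'v set \<Rightarrow> real \<Rightarrow> bool" where
  "contracting B \<rho> \<longleftrightarrow> B \<in> sets borel \<and> B \<subseteq> ball xs (R / 4) \<and> 0 \<le> \<rho> \<and>
    (\<forall>x\<in>B. \<exists>p\<in>minima R.
      (norm (x - \<gamma> *\<^sub>R gradient f x - p))\<^sup>2 + \<gamma>\<^sup>2 * (\<sigma> * (f x - f xs)) \<le> \<rho> * dev x)"

lemma ex_contracting:
  assumes "0 < \<epsilon>"
  obtains \<eta> where "0 < \<eta>"
    "\<And>B. B \<in> sets borel \<Longrightarrow> B \<subseteq> ball xs (R / 4) \<Longrightarrow> (\<And>x. x \<in> B \<Longrightarrow> infdist x (minima R) < \<eta>) \<Longrightarrow>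
      contracting B (rate \<mu> L \<sigma> \<gamma> + \<epsilon>)"
proof -
  obtain \<eta> where "0 < \<eta>" and \<eta>: "\<And>x. x \<in> ball xs (R / 4) \<Longrightarrow> infdist x (minima R) < \<eta> \<Longrightarrow>
      \<exists>p\<in>minima R. (norm (x - \<gamma> *\<^sub>R gradient f x - p))\<^sup>2 + \<gamma>\<^sup>2 * \<sigma> * (f x - f xs)
        \<le> (rate \<mu> L \<sigma> \<gamma> + \<epsilon>) * (infdist x (minima R))\<^sup>2"
    using gradient_step_contraction[OF R(2,1) sigma_nonneg gamma_pos assms] by blast
  then show ?thesis
    using that[of \<eta>] rate_nonneg[OF mu_pos sigma_nonneg, of L \<gamma>] assms
    unfolding contracting_def dev_def mult.assoc by (meson add_nonneg_nonneg less_imp_le subsetD)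
qed

text \<open>
  A measurable choice of a nearest minimum is avoided: the minimum is replaced by a point of a
  countable dense set of minima, at the price of the slack \<open>\<kappa>\<close>.
\<close>

lemma deviation_step:
  assumes B: "contracting B \<rho>" and A: "A \<in> sets (F k)" and \<theta>: "\<And>\<omega>. \<omega> \<in> A \<Longrightarrow> \<theta> k \<omega> \<in> B"
  shows "(\<integral>\<^sup>+\<omega>\<in>A. ennreal (dev (\<theta> (Suc k) \<omega>)) \<partial>M) \<le> ennreal \<rho> * (\<integral>\<^sup>+\<omega>\<in>A. ennreal (dev (\<theta> k \<omega>)) \<partial>M)"
proof (rule ennreal_le_epsilon)
  fix \<kappa> :: real assume \<kappa>: "0 < \<kappa>"
  have \<rho>: "0 \<le> \<rho>" and BR: "B \<subseteq> ball xs (R / 4)" using B by (auto simp: contracting_def)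
  define \<phi> where "\<phi> x p = (norm (x - \<gamma> *\<^sub>R gradient f x - p))\<^sup>2 + \<gamma>\<^sup>2 * (\<sigma> * (f x - f xs))" for x p
  obtain T where T: "countable T" "T \<subseteq> minima R" "minima R \<subseteq> closure T"
    using separable[of "minima R"] by blast
  have "T \<noteq> {}" using T(3) xs_in_minima[of R] R by auto
  define q where "q = from_nat_into T"
  have q: "q i \<in> minima R" for i
    using from_nat_into[OF \<open>T \<noteq> {}\<close>] T(2) by (auto simp: q_def)
  have ex_q: "\<exists>i. \<phi> x (q i) \<le> \<rho> * dev x + \<kappa>" if "x \<in> B" for x
  proof -
    obtain p where p: "p \<in> minima R" "\<phi> x p \<le> \<rho> * dev x"
      using B \<open>x \<in> B\<close> unfolding contracting_def \<phi>_def by blast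
    have "continuous_on UNIV (\<phi> x)"
      unfolding \<phi>_def by (intro continuous_intros)
    then have "open {y. \<phi> x y < \<phi> x p + \<kappa>}"
      by (intro open_Collect_less continuous_intros)
    moreover have "p \<in> {y. \<phi> x y < \<phi> x p + \<kappa>}" using \<kappa> by simp
    ultimately obtain y where y: "y \<in> T" "\<phi> x y < \<phi> x p + \<kappa>"
      using p(1) T(3) closure_iff_nhds_not_empty[of p T] by blast
    obtain i where "q i = y" using from_nat_into_surj[OF T(1) y(1)] by (auto simp: q_def)
    then show ?thesis using y p by (intro exI[of _ i]) auto
  qed
  define E where "E i = A \<inter> {\<omega> \<in> space M. \<theta> k \<omega> \<in> {x. \<phi> x (q i) \<le> \<rho> * dev x + \<kappa>}}" for i
  have "{x. \<phi> x (q i) \<le> \<rho> * dev x + \<kappa>} \<in> sets borel" for i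
    unfolding \<phi>_def by measurable
  then have E: "E i \<in> sets (F k)" for i
    unfolding E_def by (intro sets.Int A pred_theta_F) auto
  have UE: "(\<Union>i. E i) = A"
    using ex_q \<theta> sets.sets_into_space[OF sets_F[OF A]] by (fastforce simp: E_def)
  \<comment> \<open>On \<open>E' i\<close> the index \<open>i\<close> is the first one that works.
    It depends on \<open>\<theta> k\<close> and \<open>A\<close> only, so the piece is known at time
    \<open>k\<close>, and on it the minimum \<open>q i\<close> is a constant.\<close>
  define E' where "E' = disjointed E"
  have E': "E' i \<in> sets (F k)" for i
    using sets.range_disjointed_sets[of E "F k"] E by (auto simp: E'_def)
  have E'M [measurable]: "E' i \<in> sets M" for i using sets_F[OF E'] .
  have E'_sub: "E' i \<subseteq> E i" for i by (simp add: E'_def disjointed_subset)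
  have disj: "disjoint_family E'" by (simp add: E'_def disjoint_family_disjointed)
  have UE': "(\<Union>i. E' i) = A" using UE by (simp add: E'_def UN_disjointed_eq)
  have [measurable]: "A \<in> sets M" using sets_F[OF A] .
  have piece: "(\<integral>\<^sup>+\<omega>\<in>E' i. ennreal (dev (\<theta> (Suc k) \<omega>)) \<partial>M)
    \<le> (\<integral>\<^sup>+\<omega>\<in>E' i. ennreal (\<rho> * dev (\<theta> k \<omega>) + \<kappa>) \<partial>M)" for i
  proof -
    have in_ball: "\<theta> k \<omega> \<in> cball xs R" if "\<omega> \<in> E' i" for \<omega>
      using that E'_sub[of i] \<theta>[of \<omega>] BR R by (fastforce simp: E_def)
    have "(\<integral>\<^sup>+\<omega>\<in>E' i. ennreal (dev (\<theta> (Suc k) \<omega>)) \<partial>M)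
      \<le> (\<integral>\<^sup>+\<omega>\<in>E' i. ennreal ((norm ((\<theta> k \<omega> - \<gamma> *\<^sub>R gradient f (\<theta> k \<omega>) - q i) - \<gamma> *\<^sub>R D (Suc k) \<omega>))\<^sup>2) \<partial>M)"
    proof (rule nn_integral_mono_AE, use theta_Suc[of k] in eventually_elim)
      case (elim \<omega>)
      have "dev (\<theta> (Suc k) \<omega>) \<le> (norm (\<theta> (Suc k) \<omega> - q i))\<^sup>2" by (rule dev_le[OF q])
      also have "\<theta> (Suc k) \<omega> - q i = (\<theta> k \<omega> - \<gamma> *\<^sub>R gradient f (\<theta> k \<omega>) - q i) - \<gamma> *\<^sub>R D (Suc k) \<omega>"
        using elim by (simp add: algebra_simps)
      finally show ?case by (intro mult_right_mono ennreal_leI) auto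
    qed
    also have "\<dots> \<le> (\<integral>\<^sup>+\<omega>\<in>E' i. ennreal (\<phi> (\<theta> k \<omega>) (q i)) \<partial>M)"
      unfolding \<phi>_def
      using noise_step[OF E' in_ball, where g = "\<lambda>x. x - \<gamma> *\<^sub>R gradient f x - q i"]
      by (simp add: continuous_intros continuous_gradient)
    also have "\<dots> \<le> (\<integral>\<^sup>+\<omega>\<in>E' i. ennreal (\<rho> * dev (\<theta> k \<omega>) + \<kappa>) \<partial>M)"
      using E'_sub[of i] by (intro nn_integral_mono) (auto simp: E_def intro!: ennreal_leI split: split_indicator)
    finally show ?thesis .
  qed
  have "(\<integral>\<^sup>+\<omega>\<in>A. ennreal (dev (\<theta> (Suc k) \<omega>)) \<partial>M) = (\<Sum>i. \<integral>\<^sup>+\<omega>\<in>E' i. ennreal (dev (\<theta> (Suc k) \<omega>)) \<partial>M)"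
    unfolding UE'[symmetric] by (rule nn_integral_disjoint_family[OF _ _ disj]) measurable
  also have "\<dots> \<le> (\<Sum>i. \<integral>\<^sup>+\<omega>\<in>E' i. ennreal (\<rho> * dev (\<theta> k \<omega>) + \<kappa>) \<partial>M)"
    by (intro suminf_le allI piece) auto
  also have "\<dots> = (\<integral>\<^sup>+\<omega>\<in>A. ennreal (\<rho> * dev (\<theta> k \<omega>) + \<kappa>) \<partial>M)"
    unfolding UE'[symmetric] by (rule nn_integral_disjoint_family[OF _ _ disj, symmetric]) measurable
  also have "\<dots> = (\<integral>\<^sup>+\<omega>. ennreal \<rho> * (ennreal (dev (\<theta> k \<omega>)) * indicator A \<omega>) + ennreal \<kappa> * indicator A \<omega> \<partial>M)"
    using \<rho> \<kappa> by (intro nn_integral_cong) (auto simp: ennreal_plus ennreal_mult split: split_indicator)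
  also have "\<dots> = ennreal \<rho> * (\<integral>\<^sup>+\<omega>\<in>A. ennreal (dev (\<theta> k \<omega>)) \<partial>M) + ennreal \<kappa> * emeasure M A"
    by (simp add: nn_integral_add nn_integral_cmult)
  also have "\<dots> \<le> ennreal \<rho> * (\<integral>\<^sup>+\<omega>\<in>A. ennreal (dev (\<theta> k \<omega>)) \<partial>M) + ennreal \<kappa> * 1"
    using emeasure_le_1 by (intro add_left_mono mult_left_mono) auto
  finally show "(\<integral>\<^sup>+\<omega>\<in>A. ennreal (dev (\<theta> (Suc k) \<omega>)) \<partial>M)
    \<le> ennreal \<rho> * (\<integral>\<^sup>+\<omega>\<in>A. ennreal (dev (\<theta> k \<omega>)) \<partial>M) + ennreal \<kappa>" by simp
qed

text \<open>The term \<open>L\<^sup>2\<close> bounds the squared gradient,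
  \<open>\<sigma> * L\<close> the noise via \<open>f_upper\<close>.\<close>

definition step_const :: real where
  "step_const = \<gamma>\<^sup>2 * (L\<^sup>2 + \<sigma> * L)"

lemma step_const_nonneg: "0 \<le> step_const"
  using sigma_nonneg mu_pos mu_le_L by (simp add: step_const_def)

text \<open>The gradient vanishes at the minima to first order and the noise variance to second
  order in the distance, so squared increments decay as fast as \<open>dev\<close>.\<close>

lemma increment_step:
  assumes A: "A \<in> sets (F k)" and \<theta>: "\<And>\<omega>. \<omega> \<in> A \<Longrightarrow> \<theta> k \<omega> \<in> ball xs (R / 4)"
  shows "(\<integral>\<^sup>+\<omega>\<in>A. ennreal ((norm (\<theta> (Suc k) \<omega> - \<theta> k \<omega>))\<^sup>2) \<partial>M)
    \<le> ennreal step_const * (\<integral>\<^sup>+\<omega>\<in>A. ennreal (dev (\<theta> k \<omega>)) \<partial>M)"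
proof -
  have [measurable]: "A \<in> sets M" using sets_F[OF A] .
  have bound: "(norm (- \<gamma> *\<^sub>R gradient f x))\<^sup>2 + \<gamma>\<^sup>2 * (\<sigma> * (f x - f xs)) \<le> step_const * dev x"
    if x: "x \<in> ball xs (R / 4)" for x
  proof -
    obtain p where p: "p \<in> minima R" "infdist x (minima R) = norm (x - p)"
      "norm (x - p) < R / 4" "p \<in> ball xs (R / 2)"
      using nearest_minimum[OF R(2,1) x] by blast
    have fp: "f p = f xs" and pU: "p \<in> U" using p R by (auto simp: minima_def)
    have xU: "x \<in> U" using x R by auto
    have sub: "ball p (R / 4) \<subseteq> U"
    proof -
      have "dist xs z < R" if "dist p z < R / 4" for z
        using dist_triangle[of xs z p] p(4) that R by simp
      then show ?thesis using R by (fastforce intro: less_imp_le)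
    qed
    have "f x - f xs \<le> L * (norm (x - p))\<^sup>2"
      by (rule f_upper[OF sub fp]) (use p(3) in \<open>simp add: dist_norm norm_minus_commute\<close>)
    then have 1: "\<gamma>\<^sup>2 * (\<sigma> * (f x - f xs)) \<le> \<gamma>\<^sup>2 * (\<sigma> * (L * dev x))"
      using sigma_nonneg p(2) by (intro mult_left_mono) (auto simp: dev_def)
    have "norm (gradient f x) \<le> L * norm (x - p)"
      using lip[OF xU pU] gradient_eq_0[OF pU fp] by simp
    then have "(norm (gradient f x))\<^sup>2 \<le> (L * norm (x - p))\<^sup>2"
      by (intro power_mono) auto
    then have "(norm (gradient f x))\<^sup>2 \<le> L\<^sup>2 * dev x"
      using p(2) by (simp add: dev_def power_mult_distrib)
    then have "\<gamma>\<^sup>2 * (norm (gradient f x))\<^sup>2 \<le> \<gamma>\<^sup>2 * (L\<^sup>2 * dev x)"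
      by (intro mult_left_mono) auto
    with 1 show ?thesis
      by (simp add: step_const_def power_mult_distrib algebra_simps)
  qed
  have in_ball: "\<theta> k \<omega> \<in> cball xs R" if "\<omega> \<in> A" for \<omega>
    using \<theta>[OF that] R by simp
  have "(\<integral>\<^sup>+\<omega>\<in>A. ennreal ((norm (\<theta> (Suc k) \<omega> - \<theta> k \<omega>))\<^sup>2) \<partial>M)
    = (\<integral>\<^sup>+\<omega>\<in>A. ennreal ((norm (- \<gamma> *\<^sub>R gradient f (\<theta> k \<omega>) - \<gamma> *\<^sub>R D (Suc k) \<omega>))\<^sup>2) \<partial>M)"
  proof (rule nn_integral_cong_AE, use theta_Suc[of k] in eventually_elim)
    case (elim \<omega>)
    have "\<theta> (Suc k) \<omega> - \<theta> k \<omega> = - \<gamma> *\<^sub>R gradient f (\<theta> k \<omega>) - \<gamma> *\<^sub>R D (Suc k) \<omega>"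
      unfolding elim by (simp add: algebra_simps)
    then show ?case by simp
  qed
  also have "\<dots> \<le> (\<integral>\<^sup>+\<omega>\<in>A. ennreal ((norm (- \<gamma> *\<^sub>R gradient f (\<theta> k \<omega>)))\<^sup>2
      + \<gamma>\<^sup>2 * (\<sigma> * (f (\<theta> k \<omega>) - f xs))) \<partial>M)"
    by (rule noise_step[OF A in_ball, where g = "\<lambda>x. - \<gamma> *\<^sub>R gradient f x"])
      (auto intro!: continuous_intros continuous_gradient)
  also have "\<dots> \<le> (\<integral>\<^sup>+\<omega>. ennreal step_const * (ennreal (dev (\<theta> k \<omega>)) * indicator A \<omega>) \<partial>M)"
    using bound[OF \<theta>] step_const_nonneg
    by (intro nn_integral_mono) (auto simp: ennreal_mult[symmetric] intro!: ennreal_leI split: split_indicator)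
  also have "\<dots> = ennreal step_const * (\<integral>\<^sup>+\<omega>\<in>A. ennreal (dev (\<theta> k \<omega>)) \<partial>M)"
    by (rule nn_integral_cmult) measurable
  finally show ?thesis .
qed

end

section \<open>Paths that stay near the minimum\<close>

context sgd_near_minimum
begin

text \<open>For \<open>A\<close> known at time \<open>n\<close> this event is known at time
  \<open>n + k\<close>, so the next noise term can be averaged over it. It decreases in
  \<open>k\<close>.\<close>

definition stay :: "'\<omega> set \<Rightarrow> nat \<Rightarrow> 'v set \<Rightarrow> nat \<Rightarrow> '\<omega> set" where
  "stay A n B k = {\<omega> \<in> A. \<forall>j\<le>k. \<theta> (n + j) \<omega> \<in> B}"

lemma stay_sets_F:
  assumes A: "A \<in> sets (F n)" and B: "B \<in> sets borel"
  shows "stay A n B k \<in> sets (F (n + k))"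
proof -
  have "stay A n B k = A \<inter> (\<Inter>j\<in>{..k}. {\<omega> \<in> space M. \<theta> (n + j) \<omega> \<in> B})"
    using sets.sets_into_space[OF sets_F[OF A]] by (auto simp: stay_def)
  moreover have "A \<in> sets (F (n + k))"
    using A filtration.sets_F_mono[OF filtration, of n "n + k"] by auto
  moreover have "{\<omega> \<in> space M. \<theta> (n + j) \<omega> \<in> B} \<in> sets (F (n + k))" if "j \<le> k" for j
    using that B by (intro pred_theta_F) auto
  then have "(\<Inter>j\<in>{..k}. {\<omega> \<in> space M. \<theta> (n + j) \<omega> \<in> B}) \<in> sets (F (n + k))"
    by (intro sets.finite_INT) auto
  ultimately show ?thesis by auto
qed

lemma stay_sets:
  assumes "A \<in> sets (F n)" "B \<in> sets borel"
  shows "stay A n B k \<in> sets M"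
  using sets_F[OF stay_sets_F[OF assms]] .

lemma stay_deviation:
  assumes B: "contracting B \<rho>" and A: "A \<in> sets (F n)"
  shows "(\<integral>\<^sup>+\<omega>\<in>stay A n B k. ennreal (dev (\<theta> (n + k) \<omega>)) \<partial>M)
    \<le> ennreal (\<rho> ^ k) * (\<integral>\<^sup>+\<omega>\<in>stay A n B 0. ennreal (dev (\<theta> n \<omega>)) \<partial>M)"
proof (induction k)
  case (Suc k)
  have \<rho>: "0 \<le> \<rho>" and Bm: "B \<in> sets borel" using B by (auto simp: contracting_def)
  \<comment> \<open>Whether the path is still in \<open>B\<close> at the new time is not known when
    the noise is averaged, so that condition is dropped first.\<close>
  have "(\<integral>\<^sup>+\<omega>\<in>stay A n B (Suc k). ennreal (dev (\<theta> (n + Suc k) \<omega>)) \<partial>M)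
    \<le> (\<integral>\<^sup>+\<omega>\<in>stay A n B k. ennreal (dev (\<theta> (Suc (n + k)) \<omega>)) \<partial>M)"
    by (intro nn_integral_mono) (auto simp: stay_def split: split_indicator)
  also have "\<dots> \<le> ennreal \<rho> * (\<integral>\<^sup>+\<omega>\<in>stay A n B k. ennreal (dev (\<theta> (n + k) \<omega>)) \<partial>M)"
    by (rule deviation_step[OF B stay_sets_F[OF A Bm]]) (auto simp: stay_def)
  also have "\<dots> \<le> ennreal \<rho> * (ennreal (\<rho> ^ k) * (\<integral>\<^sup>+\<omega>\<in>stay A n B 0. ennreal (dev (\<theta> n \<omega>)) \<partial>M))"
    by (intro mult_left_mono Suc.IH) simp
  finally show ?case
    using \<rho> by (simp add: ennreal_mult mult.assoc)
qed simp

lemma stay_increment: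
  assumes B: "contracting B \<rho>" and A: "A \<in> sets (F n)"
  shows "(\<integral>\<^sup>+\<omega>\<in>stay A n B k. ennreal ((norm (\<theta> (Suc (n + k)) \<omega> - \<theta> (n + k) \<omega>))\<^sup>2) \<partial>M)
    \<le> ennreal (\<rho> ^ k) * (ennreal step_const * (\<integral>\<^sup>+\<omega>\<in>stay A n B 0. ennreal (dev (\<theta> n \<omega>)) \<partial>M))"
proof -
  have Bm: "B \<in> sets borel" "B \<subseteq> ball xs (R / 4)" using B by (auto simp: contracting_def)
  have "(\<integral>\<^sup>+\<omega>\<in>stay A n B k. ennreal ((norm (\<theta> (Suc (n + k)) \<omega> - \<theta> (n + k) \<omega>))\<^sup>2) \<partial>M)
    \<le> ennreal step_const * (\<integral>\<^sup>+\<omega>\<in>stay A n B k. ennreal (dev (\<theta> (n + k) \<omega>)) \<partial>M)"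
    by (rule increment_step[OF stay_sets_F[OF A Bm(1)]]) (use Bm(2) in \<open>auto simp: stay_def\<close>)
  also have "\<dots> \<le> ennreal step_const * (ennreal (\<rho> ^ k) * (\<integral>\<^sup>+\<omega>\<in>stay A n B 0. ennreal (dev (\<theta> n \<omega>)) \<partial>M))"
    by (intro mult_left_mono stay_deviation B A) simp
  finally show ?thesis by (simp add: mult.left_commute)
qed

lemma initial_deviation:
  assumes A: "A \<in> sets (F n)" and \<theta>: "\<And>\<omega>. \<omega> \<in> A \<Longrightarrow> \<theta> n \<omega> \<in> ball xs r"
  shows "(\<integral>\<^sup>+\<omega>\<in>A. ennreal (dev (\<theta> n \<omega>)) \<partial>M) \<le> ennreal (r\<^sup>2) * emeasure M A"
proof -
  have [measurable]: "A \<in> sets M" using sets_F[OF A] .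
  have "dev x \<le> r\<^sup>2" if "x \<in> ball xs r" for x
  proof -
    have "dev x \<le> (norm (x - xs))\<^sup>2" using dev_le[OF xs_in_minima] R by simp
    also have "\<dots> \<le> r\<^sup>2"
      using that by (intro power_mono) (auto simp: dist_norm norm_minus_commute)
    finally show ?thesis .
  qed
  then have "(\<integral>\<^sup>+\<omega>\<in>A. ennreal (dev (\<theta> n \<omega>)) \<partial>M) \<le> (\<integral>\<^sup>+\<omega>. ennreal (r\<^sup>2) * indicator A \<omega> \<partial>M)"
    using \<theta> by (intro nn_integral_mono) (auto intro!: ennreal_leI split: split_indicator)
  then show ?thesis by (simp add: nn_integral_cmult_indicator)
qed

lemma initial_deviation_finite:
  assumes B: "contracting B \<rho>" and A: "A \<in> sets (F n)"
  shows "(\<integral>\<^sup>+\<omega>\<in>stay A n B 0. ennreal (dev (\<theta> n \<omega>)) \<partial>M) < \<infinity>"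
proof -
  have Bm: "B \<in> sets borel" "B \<subseteq> ball xs (R / 4)" using B by (auto simp: contracting_def)
  have S: "stay A n B 0 \<in> sets (F n)" using stay_sets_F[OF A Bm(1), of 0] by simp
  have "(\<integral>\<^sup>+\<omega>\<in>stay A n B 0. ennreal (dev (\<theta> n \<omega>)) \<partial>M)
    \<le> ennreal ((R / 4)\<^sup>2) * emeasure M (stay A n B 0)"
    by (rule initial_deviation[OF S]) (use Bm(2) in \<open>auto simp: stay_def\<close>)
  also have "\<dots> < \<infinity>"
    using less_top[THEN iffD1, OF emeasure_finite[of "stay A n B 0"]]
    by (simp add: ennreal_mult_less_top)
  finally show ?thesis .
qed

lemma AE_stay_bounds:
  assumes B: "contracting B \<rho>" and A: "A \<in> sets (F n)" and t: "\<rho> < t"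
  shows "AE \<omega> in M. (\<forall>k. \<omega> \<in> stay A n B k) \<longrightarrow> (\<exists>K. \<forall>k. dev (\<theta> (n + k) \<omega>) \<le> K * t ^ k)"
    and "AE \<omega> in M. (\<forall>k. \<omega> \<in> stay A n B k) \<longrightarrow>
      (\<exists>K. \<forall>k. (norm (\<theta> (Suc (n + k)) \<omega> - \<theta> (n + k) \<omega>))\<^sup>2 \<le> K * t ^ k)"
proof -
  have Bm [measurable]: "B \<in> sets borel" and \<rho>: "0 \<le> \<rho>" using B by (auto simp: contracting_def)
  note fin = initial_deviation_finite[OF B A]
  show "AE \<omega> in M. (\<forall>k. \<omega> \<in> stay A n B k) \<longrightarrow> (\<exists>K. \<forall>k. dev (\<theta> (n + k) \<omega>) \<le> K * t ^ k)"
    by (rule AE_geometric_bound[OF _ stay_sets[OF A Bm] stay_deviation[OF B A] fin \<rho> t]) measurable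
  show "AE \<omega> in M. (\<forall>k. \<omega> \<in> stay A n B k) \<longrightarrow>
      (\<exists>K. \<forall>k. (norm (\<theta> (Suc (n + k)) \<omega> - \<theta> (n + k) \<omega>))\<^sup>2 \<le> K * t ^ k)"
    by (rule AE_geometric_bound[OF _ stay_sets[OF A Bm] stay_increment[OF B A] _ \<rho> t])
      (use fin in \<open>auto simp: ennreal_mult_less_top\<close>)
qed

text \<open>
  A path that starts in \<open>ball xs (r / 2)\<close> can leave \<open>ball xs r\<close> only if its \<open>j\<close>-th increment exceeds
  \<open>(1 - s) * s ^ j * r / 2\<close> for some \<open>j\<close>; the probabilities of these events are summable by
  Chebyshev's inequality when \<open>\<rho> < s\<^sup>2\<close>.
\<close>

lemma exit_probability:
  assumes B: "contracting (ball xs r) \<rho>" and \<rho>: "\<rho> < 1" and r: "0 < r" and \<delta>: "0 < \<delta>"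
  obtains r0 where "0 < r0" "r0 \<le> r"
    "\<And>A n. A \<in> sets (F n) \<Longrightarrow> (\<And>\<omega>. \<omega> \<in> A \<Longrightarrow> \<theta> n \<omega> \<in> ball xs r0) \<Longrightarrow>
      emeasure M (A - (\<Inter>k. stay A n (ball xs r) k)) \<le> ennreal \<delta> * emeasure M A"
proof -
  have \<rho>0: "0 \<le> \<rho>" using B by (simp add: contracting_def)
  \<comment> \<open>The square of \<open>s\<close> is the midpoint of \<open>\<rho>\<close> and 1:
    increments of size \<open>s ^ j\<close> are summable, and so are the Chebyshev bounds, of ratio
    \<open>\<rho> / s\<^sup>2\<close>.\<close>
  define s where "s = sqrt ((1 + \<rho>) / 2)"
  have s2: "s\<^sup>2 = (1 + \<rho>) / 2" using \<rho>0 by (simp add: s_def)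
  have s: "0 < s" "s < 1" "\<rho> < s\<^sup>2" using \<rho> \<rho>0 s2 by (auto simp: s_def)
  \<comment> \<open>The allowed increments \<open>c * s ^ j\<close> add up to
    \<open>r / 2\<close>.\<close>
  define c where "c = (1 - s) * (r / 2)"
  have c: "0 < c" using s r by (simp add: c_def)
  \<comment> \<open>The sum of all Chebyshev bounds is \<open>Q\<close> times the squared starting
    radius, relative to the probability of \<open>A\<close>; \<open>r0\<close> is chosen to make
    this at most \<open>\<delta>\<close>.\<close>
  define Q where "Q = step_const / c\<^sup>2 * (1 / (1 - \<rho> / s\<^sup>2))"
  have Q: "0 \<le> Q" using step_const_nonneg s \<rho>0 by (auto simp: Q_def)
  define r0 where "r0 = min (r / 2) (sqrt (\<delta> / (Q + 1)))"
  have r0: "0 < r0" "r0 \<le> r / 2" using r \<delta> Q by (auto simp: r0_def)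
  have "r0\<^sup>2 \<le> (sqrt (\<delta> / (Q + 1)))\<^sup>2" using r0 by (intro power_mono) (auto simp: r0_def)
  then have "r0\<^sup>2 * (Q + 1) \<le> \<delta>" using \<delta> Q by (simp add: pos_le_divide_eq)
  then have Qr0: "Q * r0\<^sup>2 \<le> \<delta>" by (simp add: algebra_simps)
      (smt (verit) zero_le_power2)
  show ?thesis
  proof (rule that[of r0])
    fix A n assume A: "A \<in> sets (F n)" and start: "\<And>\<omega>. \<omega> \<in> A \<Longrightarrow> \<theta> n \<omega> \<in> ball xs r0"
    let ?B = "ball xs r"
    have Bm: "?B \<in> sets borel" by simp
    note [measurable] = sets_F[OF A] stay_sets[OF A Bm]
    define X where "X j \<omega> = (norm (\<theta> (Suc (n + j)) \<omega> - \<theta> (n + j) \<omega>))\<^sup>2" for j \<omega>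
    have [measurable]: "X j \<in> borel_measurable M" for j unfolding X_def by measurable
    define bad where "bad j = {\<omega> \<in> space M. \<omega> \<in> stay A n ?B j \<and> (c * s ^ j)\<^sup>2 < X j \<omega>}" for j
    have [measurable]: "bad j \<in> sets M" for j unfolding bad_def by measurable
    have sub: "A - (\<Inter>k. stay A n ?B k) \<subseteq> (\<Union>j. bad j)"
    proof
      fix \<omega> assume \<omega>: "\<omega> \<in> A - (\<Inter>k. stay A n ?B k)"
      show "\<omega> \<in> (\<Union>j. bad j)"
      proof (rule ccontr)
        assume nb: "\<omega> \<notin> (\<Union>j. bad j)"
        have sp: "\<omega> \<in> space M" using \<omega> sets.sets_into_space[OF sets_F[OF A]] by auto
        have d0: "dist xs (\<theta> n \<omega>) < r / 2" using start[of \<omega>] \<omega> r0 by auto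
        \<comment> \<open>Staying up to time \<open>k\<close> and avoiding \<open>bad j\<close> for
          \<open>j \<le> k\<close> bounds the increments through time \<open>k + 1\<close>, which
          keeps the path in the ball one step longer.\<close>
        have "\<omega> \<in> stay A n ?B k" for k
        proof (induction k)
          case 0
          then show ?case using \<omega> d0 r by (auto simp: stay_def)
        next
          case (Suc k)
          have "norm (\<theta> (Suc (n + j)) \<omega> - \<theta> (n + j) \<omega>) \<le> c * s ^ j" if "j < Suc k" for j
          proof (rule power2_le_imp_le)
            have "\<omega> \<in> stay A n ?B j" using Suc that by (auto simp: stay_def)
            then show "(norm (\<theta> (Suc (n + j)) \<omega> - \<theta> (n + j) \<omega>))\<^sup>2 \<le> (c * s ^ j)\<^sup>2"
              using nb sp by (auto simp: bad_def X_def not_less)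
          qed (use c s in auto)
          then have "norm (\<theta> (n + Suc k) \<omega> - \<theta> (n + 0) \<omega>) \<le> c * (1 - s ^ Suc k) / (1 - s)"
            using s by (intro dist_le_geometric_steps[of "Suc k" "\<lambda>j. \<theta> (n + j) \<omega>"]) auto
          also have "\<dots> = r / 2 * (1 - s ^ Suc k)"
          proof -
            have "1 - s \<noteq> 0" using s by simp
            then show ?thesis unfolding c_def mult.assoc by (rule nonzero_mult_div_cancel_left)
          qed
          also have "\<dots> \<le> r / 2 * 1" using s r by (intro mult_left_mono) auto
          finally have "dist (\<theta> n \<omega>) (\<theta> (n + Suc k) \<omega>) \<le> r / 2"
            by (simp add: dist_norm norm_minus_commute)
          then have "\<theta> (n + Suc k) \<omega> \<in> ?B"
            using dist_triangle[of xs "\<theta> (n + Suc k) \<omega>" "\<theta> n \<omega>"] d0 by simp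
          then show ?case using Suc by (auto simp: stay_def le_Suc_eq)
        qed
        then show False using \<omega> by auto
      qed
    qed
    have stay0: "(\<integral>\<^sup>+\<omega>\<in>stay A n ?B 0. ennreal (dev (\<theta> n \<omega>)) \<partial>M) \<le> ennreal (r0\<^sup>2) * emeasure M A"
    proof -
      have "(\<integral>\<^sup>+\<omega>\<in>stay A n ?B 0. ennreal (dev (\<theta> n \<omega>)) \<partial>M) \<le> (\<integral>\<^sup>+\<omega>\<in>A. ennreal (dev (\<theta> n \<omega>)) \<partial>M)"
        by (intro nn_integral_mono) (auto simp: stay_def split: split_indicator)
      also have "\<dots> \<le> ennreal (r0\<^sup>2) * emeasure M A" by (rule initial_deviation[OF A start])
      finally show ?thesis .
    qed
    have bad: "emeasure M (bad j) \<le> ennreal ((\<rho> / s\<^sup>2) ^ j) * ennreal (step_const / c\<^sup>2 * r0\<^sup>2) * emeasure M A" for j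
    proof -
      have pos: "0 < (c * s ^ j)\<^sup>2" using c s by simp
      have "emeasure M (bad j) = (\<integral>\<^sup>+\<omega>. indicator (bad j) \<omega> \<partial>M)" by simp
      also have "\<dots> \<le> (\<integral>\<^sup>+\<omega>. ennreal (1 / (c * s ^ j)\<^sup>2) * (ennreal (X j \<omega>) * indicator (stay A n ?B j) \<omega>) \<partial>M)"
      proof (intro nn_integral_mono)
        fix \<omega>
        show "indicator (bad j) \<omega> \<le> ennreal (1 / (c * s ^ j)\<^sup>2) * (ennreal (X j \<omega>) * indicator (stay A n ?B j) \<omega>)"
        proof (cases "\<omega> \<in> bad j")
          case True
          then have "1 \<le> 1 / (c * s ^ j)\<^sup>2 * X j \<omega>" using pos by (simp add: bad_def field_simps)
          then have "1 \<le> ennreal (1 / (c * s ^ j)\<^sup>2) * ennreal (X j \<omega>)"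
            using pos by (simp add: ennreal_mult'[symmetric] del: times_divide_eq_left)
          then show ?thesis using True by (simp add: bad_def)
        qed simp
      qed
      also have "\<dots> = ennreal (1 / (c * s ^ j)\<^sup>2) * (\<integral>\<^sup>+\<omega>\<in>stay A n ?B j. ennreal (X j \<omega>) \<partial>M)"
        by (rule nn_integral_cmult) measurable
      also have "\<dots> \<le> ennreal (1 / (c * s ^ j)\<^sup>2) * (ennreal (\<rho> ^ j) * (ennreal step_const *
          (ennreal (r0\<^sup>2) * emeasure M A)))"
        unfolding X_def
        by (intro mult_left_mono order_trans[OF stay_increment[OF B A]] stay0) auto
      also have "\<dots> = ennreal (1 / (c * s ^ j)\<^sup>2 * \<rho> ^ j * (step_const * r0\<^sup>2)) * emeasure M A"
        using \<rho>0 step_const_nonneg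
        by (simp add: ennreal_mult mult.assoc del: times_divide_eq_left)
      also have "1 / (c * s ^ j)\<^sup>2 * \<rho> ^ j * (step_const * r0\<^sup>2) = (\<rho> / s\<^sup>2) ^ j * (step_const / c\<^sup>2 * r0\<^sup>2)"
        by (simp add: power_divide power_mult_distrib mult_ac flip: power_mult)
      finally show ?thesis
        using \<rho>0 step_const_nonneg by (simp add: ennreal_mult del: times_divide_eq_left)
    qed
    have "emeasure M (A - (\<Inter>k. stay A n ?B k)) \<le> emeasure M (\<Union>j. bad j)"
      by (intro emeasure_mono sub) measurable
    also have "\<dots> \<le> (\<Sum>j. emeasure M (bad j))"
      by (intro emeasure_subadditive_countably) auto
    also have "\<dots> \<le> (\<Sum>j. ennreal ((\<rho> / s\<^sup>2) ^ j) * ennreal (step_const / c\<^sup>2 * r0\<^sup>2) * emeasure M A)"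
      by (intro suminf_le allI bad) auto
    also have "\<dots> = ennreal (\<Sum>j. (\<rho> / s\<^sup>2) ^ j) * ennreal (step_const / c\<^sup>2 * r0\<^sup>2) * emeasure M A"
      using \<rho>0 s by (simp add: suminf_ennreal_eq[OF _ summable_sums] summable_geometric)
    also have "(\<Sum>j. (\<rho> / s\<^sup>2) ^ j) = 1 / (1 - \<rho> / s\<^sup>2)"
      using \<rho>0 s by (intro suminf_geometric) auto
    also have "ennreal (1 / (1 - \<rho> / s\<^sup>2)) * ennreal (step_const / c\<^sup>2 * r0\<^sup>2) = ennreal (Q * r0\<^sup>2)"
      using \<rho>0 s step_const_nonneg by (simp add: Q_def mult_ac flip: ennreal_mult)
    also have "\<dots> * emeasure M A \<le> ennreal \<delta> * emeasure M A"
      by (intro mult_right_mono ennreal_leI Qr0) simp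
    finally show "emeasure M (A - (\<Inter>k. stay A n ?B k)) \<le> ennreal \<delta> * emeasure M A" .
  qed (use r0 r in auto)
qed

section \<open>Limits and rates of single paths\<close>

lemma AE_stay_converges:
  assumes B: "contracting (ball xs r) \<rho>" and \<rho>: "\<rho> < 1" and A: "A \<in> sets (F n)"
  shows "AE \<omega> in M. (\<forall>k. \<omega> \<in> stay A n (ball xs r) k) \<longrightarrow>
    (\<exists>l. (\<lambda>k. \<theta> k \<omega>) \<longlonglongrightarrow> l \<and> l \<in> minima R)"
proof -
  have \<rho>0: "0 \<le> \<rho>" using B by (simp add: contracting_def)
  define t where "t = (1 + \<rho>) / 2"
  have t: "0 < t" "t < 1" "\<rho> < t" using \<rho> \<rho>0 by (auto simp: t_def)
  have cl: "closed (minima R)" by (intro compact_imp_closed compact_minima R)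
  have ne: "minima R \<noteq> {}" using xs_in_minima[of R] R by auto
  show ?thesis
    using AE_stay_bounds(1)[OF B A t(3)] AE_stay_bounds(2)[OF B A t(3)]
  proof eventually_elim
    case (elim \<omega>)
    show ?case
    proof
      assume stay: "\<forall>k. \<omega> \<in> stay A n (ball xs r) k"
      obtain K where K: "\<And>k. dev (\<theta> (n + k) \<omega>) \<le> K * t ^ k" using elim stay by blast
      obtain K' where K': "\<And>k. (norm (\<theta> (Suc (n + k)) \<omega> - \<theta> (n + k) \<omega>))\<^sup>2 \<le> K' * t ^ k"
        using elim stay by blast
      have "(norm (\<theta> (n + Suc k) \<omega> - \<theta> (n + k) \<omega>))\<^sup>2 \<le> K' * t ^ k" for k using K'[of k] by simp
      from geometric_steps_converge[of t "\<lambda>k. \<theta> (n + k) \<omega>", OF t(1,2) this]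
      obtain l where l: "(\<lambda>k. \<theta> (n + k) \<omega>) \<longlonglongrightarrow> l" by blast
      have "(\<lambda>k. K * t ^ k) \<longlonglongrightarrow> 0"
        using t by (intro tendsto_mult_right_zero LIMSEQ_power_zero) auto
      then have "(\<lambda>k. dev (\<theta> (n + k) \<omega>)) \<longlonglongrightarrow> 0"
        by (rule tendsto_sandwich[OF _ _ tendsto_const, rotated 2]) (simp_all add: K)
      moreover have "(\<lambda>k. dev (\<theta> (n + k) \<omega>)) \<longlonglongrightarrow> dev l"
        unfolding dev_def by (intro tendsto_intros tendsto_infdist l)
      ultimately have "dev l = 0" using LIMSEQ_unique by blast
      then have "l \<in> minima R" by (simp add: dev_def in_closed_iff_infdist_zero[OF cl ne])
      moreover have "(\<lambda>k. \<theta> (k + n) \<omega>) \<longlonglongrightarrow> l" using l by (simp add: add.commute)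
      then have "(\<lambda>k. \<theta> k \<omega>) \<longlonglongrightarrow> l" by (rule LIMSEQ_offset)
      ultimately show "\<exists>l. (\<lambda>k. \<theta> k \<omega>) \<longlonglongrightarrow> l \<and> l \<in> minima R" by blast
    qed
  qed
qed

text \<open>
  Near the set of minima the contraction factor is arbitrarily close to the optimal rate, so the
  bounds are applied again after the time \<open>N\<close> at which the path enters such a neighbourhood for good.
\<close>

lemma AE_rate:
  assumes r: "0 < r" "r \<le> R / 4" and \<gamma>: "\<gamma> < 2 / (L + \<sigma> / 2)" and a: "rate \<mu> L \<sigma> \<gamma> < a"
  shows "AE \<omega> in M. \<forall>l n. (\<forall>k\<ge>n. \<theta> k \<omega> \<in> ball xs r) \<longrightarrow> (\<lambda>k. \<theta> k \<omega>) \<longlonglongrightarrow> l \<longrightarrow> l \<in> minima R \<longrightarrow>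
    (\<lambda>k. a powi (- int k) * (norm (\<theta> k \<omega> - l))\<^sup>2) \<longlonglongrightarrow> 0"
proof -
  let ?m = "rate \<mu> L \<sigma> \<gamma>"
  have m: "0 \<le> ?m" "?m < 1"
    using rate_nonneg[OF mu_pos sigma_nonneg] rate_less_1[OF mu_pos mu_le_L sigma_nonneg gamma_pos \<gamma>]
    by auto
  \<comment> \<open>Room is needed twice: \<open>\<rho>\<close> exceeds the rate to cover the
    linearisation, \<open>t\<close> exceeds \<open>\<rho>\<close> for the pathwise bound, and
    \<open>a\<close> exceeds \<open>t\<close> so that the limit is 0.\<close>
  define t where "t = (?m + min 1 a) / 2"
  have t: "0 < t" "t < 1" "t < a" "?m < t" using m a by (auto simp: t_def min_def)
  define \<rho> where "\<rho> = (?m + t) / 2"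
  have \<rho>: "\<rho> < t" "0 < \<rho> - ?m" using t by (auto simp: \<rho>_def)
  obtain \<eta> where \<eta>: "0 < \<eta>" "\<And>B. B \<in> sets borel \<Longrightarrow> B \<subseteq> ball xs (R / 4) \<Longrightarrow>
      (\<And>x. x \<in> B \<Longrightarrow> infdist x (minima R) < \<eta>) \<Longrightarrow> contracting B (?m + (\<rho> - ?m))"
    using ex_contracting[OF \<rho>(2)] by blast
  define B where "B = {x \<in> ball xs r. infdist x (minima R) < \<eta>}"
  have B: "B \<in> sets borel" unfolding B_def by measurable
  have "B \<subseteq> ball xs (R / 4)" using r by (auto simp: B_def)
  moreover have "infdist x (minima R) < \<eta>" if "x \<in> B" for x using that by (simp add: B_def)
  ultimately have con: "contracting B \<rho>"
    using \<eta>(2)[OF B] by simp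
  define A where "A N = {\<omega> \<in> space M. \<theta> N \<omega> \<in> B}" for N
  have A: "A N \<in> sets (F N)" for N
    unfolding A_def by (rule pred_theta_F[OF B order_refl])
  \<comment> \<open>The entry time will depend on the path, so the bound is secured for all
    deterministic \<open>N\<close> outside one null set.\<close>
  have "AE \<omega> in M. \<forall>N. (\<forall>k. \<omega> \<in> stay (A N) N B k) \<longrightarrow>
      (\<exists>K. \<forall>k. (norm (\<theta> (Suc (N + k)) \<omega> - \<theta> (N + k) \<omega>))\<^sup>2 \<le> K * t ^ k)"
    using AE_stay_bounds(2)[OF con A \<rho>(1)] by (simp add: AE_all_countable)
  then show ?thesis
  proof (rule AE_mp, intro AE_I2 impI allI)
    fix \<omega> l n
    assume \<omega>: "\<omega> \<in> space M"
      and bound: "\<forall>N. (\<forall>k. \<omega> \<in> stay (A N) N B k) \<longrightarrow>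
        (\<exists>K. \<forall>k. (norm (\<theta> (Suc (N + k)) \<omega> - \<theta> (N + k) \<omega>))\<^sup>2 \<le> K * t ^ k)"
      and n: "\<forall>k\<ge>n. \<theta> k \<omega> \<in> ball xs r" and l: "(\<lambda>k. \<theta> k \<omega>) \<longlonglongrightarrow> l" "l \<in> minima R"
    have "(\<lambda>k. infdist (\<theta> k \<omega>) (minima R)) \<longlonglongrightarrow> infdist l (minima R)"
      by (intro tendsto_infdist l)
    then have "eventually (\<lambda>k. infdist (\<theta> k \<omega>) (minima R) < \<eta>) sequentially"
      using \<eta>(1) l(2) by (intro order_tendstoD(2)) auto
    then obtain N0 where N0: "\<And>k. N0 \<le> k \<Longrightarrow> infdist (\<theta> k \<omega>) (minima R) < \<eta>"
      by (auto simp: eventually_sequentially)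
    define N where "N = max n N0"
    have "\<theta> k \<omega> \<in> B" if "N \<le> k" for k using that N0[of k] n by (auto simp: B_def N_def)
    then have "\<forall>k. \<omega> \<in> stay (A N) N B k" using \<omega> by (auto simp: stay_def A_def)
    with bound obtain K where K: "\<And>k. (norm (\<theta> (Suc (N + k)) \<omega> - \<theta> (N + k) \<omega>))\<^sup>2 \<le> K * t ^ k"
      by blast
    have "(norm (\<theta> (N + Suc k) \<omega> - \<theta> (N + k) \<omega>))\<^sup>2 \<le> K * t ^ k" for k using K[of k] by simp
    from geometric_steps_converge[of t "\<lambda>k. \<theta> (N + k) \<omega>", OF t(1,2) this]
    obtain l' K' where l': "(\<lambda>k. \<theta> (N + k) \<omega>) \<longlonglongrightarrow> l'"
      and K': "\<And>k. (norm (\<theta> (N + k) \<omega> - l'))\<^sup>2 \<le> K' * t ^ k" by blast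
    have "(\<lambda>k. \<theta> (N + k) \<omega>) \<longlonglongrightarrow> l"
      using LIMSEQ_ignore_initial_segment[OF l(1), of N] by (simp add: add.commute)
    then have ll: "l' = l" using l' LIMSEQ_unique by blast
    have apos: "0 < a" using t by simp
    have "(\<lambda>k. a powi (- int (k + N)) * (norm (\<theta> (k + N) \<omega> - l))\<^sup>2) \<longlonglongrightarrow> 0"
    proof (rule tendsto_sandwich[OF _ _ tendsto_const])
      have "(\<lambda>k. K' / a ^ N * (t / a) ^ k) \<longlonglongrightarrow> 0"
        using t apos by (intro tendsto_mult_right_zero LIMSEQ_power_zero) auto
      then show "(\<lambda>k. K' * t ^ k / a ^ (k + N)) \<longlonglongrightarrow> 0"
        by (simp add: power_add power_divide mult.commute)
      show "eventually (\<lambda>k. 0 \<le> a powi (- int (k + N)) * (norm (\<theta> (k + N) \<omega> - l))\<^sup>2) sequentially"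
        using apos by (intro always_eventually allI mult_nonneg_nonneg zero_le_power_int) auto
      show "eventually (\<lambda>k. a powi (- int (k + N)) * (norm (\<theta> (k + N) \<omega> - l))\<^sup>2 \<le> K' * t ^ k / a ^ (k + N)) sequentially"
        using K'[unfolded ll] apos
        by (intro always_eventually allI)
          (auto simp: power_int_minus divide_inverse mult.commute[of "inverse _"] add.commute[of _ N]
            simp flip: of_nat_add intro!: mult_right_mono)
    qed
    then show "(\<lambda>k. a powi (- int k) * (norm (\<theta> k \<omega> - l))\<^sup>2) \<longlonglongrightarrow> 0"
      by (rule LIMSEQ_offset)
  qed
qed

lemma value_rate:
  assumes l: "x \<longlonglongrightarrow> l" "l \<in> minima R" "l \<in> ball xs R" and a: "0 < a"
    and rate: "(\<lambda>k. a powi (- int k) * (norm (x k - l))\<^sup>2) \<longlonglongrightarrow> 0"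
  shows "(\<lambda>k. a powi (- int k) * (f (x k) - f l)) \<longlonglongrightarrow> 0"
proof -
  have fl: "f l = f xs" using l(2) by (simp add: minima_def)
  have "l \<in> U" using l(3) R by auto
  then obtain e where e: "0 < e" "ball l e \<subseteq> U" using open_U open_contains_ball by blast
  have "eventually (\<lambda>k. x k \<in> ball l e) sequentially"
    using l(1) e(1) by (intro topological_tendstoD) auto
  then have ev: "eventually (\<lambda>k. 0 \<le> f (x k) - f l \<and> f (x k) - f l \<le> L * (norm (x k - l))\<^sup>2) sequentially"
  proof eventually_elim
    case (elim k)
    then show ?case using f_upper[OF e(2) fl elim] minimal[of "x k"] e(2) by (auto simp: fl)
  qed
  show ?thesis
  proof (rule tendsto_sandwich[OF _ _ tendsto_const])
    show "(\<lambda>k. L * (a powi (- int k) * (norm (x k - l))\<^sup>2)) \<longlonglongrightarrow> 0"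
      by (rule tendsto_mult_right_zero[OF rate])
    show "eventually (\<lambda>k. 0 \<le> a powi (- int k) * (f (x k) - f l)) sequentially"
      using ev by eventually_elim (use a in \<open>auto intro!: mult_nonneg_nonneg zero_le_power_int\<close>)
    show "eventually (\<lambda>k. a powi (- int k) * (f (x k) - f l) \<le> L * (a powi (- int k) * (norm (x k - l))\<^sup>2)) sequentially"
      using ev
    proof eventually_elim
      case (elim k)
      then have "a powi (- int k) * (f (x k) - f l) \<le> a powi (- int k) * (L * (norm (x k - l))\<^sup>2)"
        using a by (intro mult_left_mono zero_le_power_int) auto
      then show ?case by (simp add: mult.left_commute)
    qed
  qed
qed

end

section \<open>First entry times and conclusion\<close>

theorem theorem1p3:
  fixes M :: "'\<omega> measure"
    and F :: "nat \<Rightarrow> '\<omega> measure"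
    and f :: "real ^ 'd \<Rightarrow> real"
    and \<theta> D :: "nat \<Rightarrow> '\<omega> \<Rightarrow> real ^ 'd"
    and \<theta>star :: "real ^ 'd"
    and \<mu> L \<sigma> \<gamma> :: real
  assumes "prob_space M"
    and "filtration (space M) F"
    and "\<And>k. subalgebra M (F k)"
    and "0 < \<mu>" and "\<mu> \<le> L" and "0 \<le> \<sigma>"
    and "continuously_differentiable_on UNIV f"
    and "sgd_scheme M F f \<gamma> \<theta> D"
    and "0 < \<gamma>" and "\<gamma> < 2 / (L + \<sigma> / 2)"
    and "regular_point M F f \<theta> D \<mu> L \<sigma> \<theta>star"
  shows "\<forall>\<delta>>0. \<exists>V. open V \<and> \<theta>star \<in> V \<and>
    (let VV = (\<Union>k. {\<omega> \<in> space M. \<theta> k \<omega> \<in> V}) in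
      \<exists>C \<in> sets M.
        measure M (C \<inter> VV) \<ge> (1 - \<delta>) * measure M VV \<and>
        (\<exists>\<theta>inf \<in> borel_measurable M.
          (AE \<omega> in M. \<omega> \<in> C \<inter> VV \<longrightarrow>
             (\<lambda>k. \<theta> k \<omega>) \<longlonglongrightarrow> \<theta>inf \<omega> \<and>
             local_minimum f (\<theta>inf \<omega>) \<and> f (\<theta>inf \<omega>) = f \<theta>star) \<and>
          (\<forall>\<epsilon>>0. AE \<omega> in M. \<omega> \<in> C \<inter> VV \<longrightarrow>
             limsup (\<lambda>k. ereal ((rate \<mu> L \<sigma> \<gamma> + \<epsilon>) powi (- int k) * (norm (\<theta> k \<omega> - \<theta>inf \<omega>))\<^sup>2)) = 0 \<and>
             limsup (\<lambda>k. ereal ((rate \<mu> L \<sigma> \<gamma> + \<epsilon>) powi (- int k) * (f (\<theta> k \<omega>) - f (\<theta>inf \<omega>)))) = 0)))"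
proof -
  obtain U where U: "open U" "\<theta>star \<in> U" "twice_continuously_differentiable_on U f"
    "\<And>x. x \<in> U \<Longrightarrow> f \<theta>star \<le> f x"
    "\<And>x. x \<in> U \<Longrightarrow> 2 * \<mu> * (f x - f \<theta>star) \<le> (norm (gradient f x))\<^sup>2"
    "\<And>x y. x \<in> U \<Longrightarrow> y \<in> U \<Longrightarrow> norm (gradient f x - gradient f y) \<le> L * norm (x - y)"
    and noise: "\<And>k. 1 \<le> k \<Longrightarrow> AE \<omega> in M. \<theta> (k - 1) \<omega> \<in> U \<longrightarrow>
      vec_cond_exp M (F (k - 1)) (D k) \<omega> = 0 \<and>
      nn_cond_exp M (F (k - 1)) (\<lambda>\<omega>. ennreal ((norm (D k \<omega>))\<^sup>2)) \<omega>
        \<le> ennreal (\<sigma> * (f (\<theta> (k - 1) \<omega>) - f \<theta>star))"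
    using assms(11) unfolding regular_point_def by auto
  obtain H where H: "\<And>x. x \<in> U \<Longrightarrow> (gradient f has_derivative blinfun_apply (H x)) (at x)"
    "continuous_on U H"
    using U(3) unfolding twice_continuously_differentiable_on_def by blast
  have diff: "f differentiable (at x)" for x
    using assms(7) by (simp add: continuously_differentiable_on_def)
  obtain R where R: "0 < R" "cball \<theta>star R \<subseteq> U"
    using U(1,2) open_contains_cball by blast
  interpret prob_space M by (rule assms(1))
  interpret pl_region f H U \<theta>star \<mu> L
    by unfold_locales (use U H diff assms in auto)
  have "AE \<omega> in M. \<theta> (k - 1) \<omega> \<in> U \<longrightarrow>
      nn_cond_exp M (F (k - 1)) (\<lambda>\<omega>. ennreal ((norm (D k \<omega>))\<^sup>2)) \<omega>
        \<le> ennreal (\<sigma> * (f (\<theta> (k - 1) \<omega>) - f \<theta>star))" if "1 \<le> k" for k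
    using noise[OF that] by eventually_elim blast
  then interpret sgd_near_minimum f H U \<theta>star \<mu> L M F \<theta> D \<gamma> \<sigma> R
    by (intro sgd_near_minimum.intro sgd_near_minimum_axioms.intro
        pl_region_axioms prob_space_axioms assms R)
  have [measurable]: "\<theta> k \<in> borel_measurable M" for k by (rule theta_measurable)
  let ?m = "rate \<mu> L \<sigma> \<gamma>"
  have m: "0 \<le> ?m" "?m < 1"
    using rate_nonneg rate_less_1 assms by auto
  \<comment> \<open>Confinement only needs a factor below 1; the sharp rate is recovered by
    \<open>AE_rate\<close>.\<close>
  define \<rho> where "\<rho> = (1 + ?m) / 2"
  have \<rho>: "\<rho> < 1" "0 < \<rho> - ?m" using m by (auto simp: \<rho>_def)
  obtain \<eta> where \<eta>: "0 < \<eta>" "\<And>B. B \<in> sets borel \<Longrightarrow> B \<subseteq> ball \<theta>star (R / 4) \<Longrightarrow>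
      (\<And>x. x \<in> B \<Longrightarrow> infdist x (minima R) < \<eta>) \<Longrightarrow> contracting B (?m + (\<rho> - ?m))"
    using ex_contracting[OF \<rho>(2)] by blast
  define r where "r = min \<eta> (R / 4)"
  have r: "0 < r" "r \<le> R / 4" "r \<le> \<eta>" using \<eta>(1) R(1) by (auto simp: r_def)
  let ?B = "ball \<theta>star r"
  have B: "contracting ?B \<rho>"
  proof -
    have "infdist x (minima R) < \<eta>" if "x \<in> ?B" for x
      using infdist_le[OF xs_in_minima, of R x] that R(1) r(3) by (simp add: dist_commute)
    moreover have "?B \<subseteq> ball \<theta>star (R / 4)" using r(2) by auto
    ultimately show ?thesis using \<eta>(2)[of ?B] by simp
  qed
  show ?thesis
  proof (intro allI impI)
    fix \<delta> :: real assume "0 < \<delta>"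
    then obtain r0 where r0: "0 < r0" "r0 \<le> r" and exit: "\<And>A n. A \<in> sets (F n) \<Longrightarrow>
        (\<And>\<omega>. \<omega> \<in> A \<Longrightarrow> \<theta> n \<omega> \<in> ball \<theta>star r0) \<Longrightarrow>
        emeasure M (A - (\<Inter>k. stay A n ?B k)) \<le> ennreal \<delta> * emeasure M A"
      using exit_probability[OF B \<rho>(1) r(1)] by metis
    define V where "V = ball \<theta>star r0"
    define VV where "VV = (\<Union>k. {\<omega> \<in> space M. \<theta> k \<omega> \<in> V})"
    define E where "E n = {\<omega> \<in> space M. \<theta> n \<omega> \<in> V}" for n
    \<comment> \<open>\<open>A n\<close> is the event of first entry into \<open>V\<close> at time
      \<open>n\<close>. It is known at time \<open>n\<close>, and disjointness lets the exit bounds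
      add up to \<open>\<delta>\<close> times the probability of \<open>VV\<close>.\<close>
    define A where "A = disjointed E"
    have E_F: "E j \<in> sets (F n)" if "j \<le> n" for j n
      unfolding E_def V_def by (rule pred_theta_F[OF _ that]) simp
    have A_F: "A n \<in> sets (F n)" for n
      unfolding A_def disjointed_def using E_F by (intro sets.Diff sets.finite_UN) auto
    have [measurable]: "A n \<in> sets M" for n using sets_F[OF A_F] .
    have A_start: "\<theta> n \<omega> \<in> ball \<theta>star r0" if "\<omega> \<in> A n" for n \<omega>
      using that disjointed_subset[of E n] by (auto simp: A_def E_def V_def)
    have UA: "(\<Union>n. A n) = VV"
      by (simp add: A_def UN_disjointed_eq VV_def E_def)
    have disj: "disjoint_family A" by (simp add: A_def disjoint_family_disjointed)
    have VV [measurable]: "VV \<in> sets M" unfolding UA[symmetric] by measurable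
    have [measurable]: "stay (A n) n ?B k \<in> sets M" for n k
      by (rule stay_sets[OF A_F]) simp
    \<comment> \<open>After first entering \<open>V\<close>, a path in \<open>C\<close> may leave
      \<open>V\<close> again but never the larger ball.\<close>
    define C where "C = (\<Union>n. \<Inter>k. stay (A n) n ?B k)"
    have C [measurable]: "C \<in> sets M" unfolding C_def by measurable
    have CVV: "C \<inter> VV = C" unfolding UA[symmetric] C_def by (auto simp: stay_def)
    have "emeasure M (VV - C) \<le> emeasure M (\<Union>n. A n - (\<Inter>k. stay (A n) n ?B k))"
      unfolding UA[symmetric] C_def by (intro emeasure_mono) auto
    also have "\<dots> \<le> (\<Sum>n. emeasure M (A n - (\<Inter>k. stay (A n) n ?B k)))"
      by (intro emeasure_subadditive_countably) auto
    also have "\<dots> \<le> (\<Sum>n. ennreal \<delta> * emeasure M (A n))"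
      by (intro suminf_le allI exit A_F A_start) auto
    also have "\<dots> = ennreal \<delta> * emeasure M VV"
      unfolding UA[symmetric] ennreal_suminf_cmult
      by (subst suminf_emeasure[OF _ disj]) auto
    finally have "measure M (VV - C) \<le> \<delta> * measure M VV"
      using \<open>0 < \<delta>\<close> by (simp add: emeasure_eq_measure flip: ennreal_mult)
    moreover have "measure M (VV - C) = measure M VV - measure M C"
      using CVV by (intro finite_measure_Diff) auto
    ultimately have meas: "(1 - \<delta>) * measure M VV \<le> measure M (C \<inter> VV)"
      by (simp add: CVV algebra_simps)
    \<comment> \<open>Where a path diverges, \<open>lim\<close> is an unspecified constant, so
      \<open>\<theta>inf\<close> is measurable on the whole space; only its values on
      \<open>C\<close> matter.\<close>
    define \<theta>inf where "\<theta>inf \<omega> = lim (\<lambda>k. \<theta> k \<omega>)" for \<omega>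
    have \<theta>inf_meas: "\<theta>inf \<in> borel_measurable M"
      unfolding \<theta>inf_def by measurable
    have "AE \<omega> in M. \<forall>n. (\<forall>k. \<omega> \<in> stay (A n) n ?B k) \<longrightarrow>
        (\<exists>l. (\<lambda>k. \<theta> k \<omega>) \<longlonglongrightarrow> l \<and> l \<in> minima R)"
      unfolding AE_all_countable by (intro allI AE_stay_converges[OF B \<rho>(1) A_F])
    then have conv: "AE \<omega> in M. \<omega> \<in> C \<longrightarrow> (\<lambda>k. \<theta> k \<omega>) \<longlonglongrightarrow> \<theta>inf \<omega> \<and> \<theta>inf \<omega> \<in> minima R \<and>
        (\<exists>n. \<forall>k\<ge>n. \<theta> k \<omega> \<in> ?B)"
    proof (rule AE_mp, intro AE_I2 impI)
      fix \<omega>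
      assume *: "\<forall>n. (\<forall>k. \<omega> \<in> stay (A n) n ?B k) \<longrightarrow>
        (\<exists>l. (\<lambda>k. \<theta> k \<omega>) \<longlonglongrightarrow> l \<and> l \<in> minima R)" and "\<omega> \<in> C"
      then obtain n where n: "\<And>k. \<omega> \<in> stay (A n) n ?B k" by (auto simp: C_def)
      with * obtain l where l: "(\<lambda>k. \<theta> k \<omega>) \<longlonglongrightarrow> l" "l \<in> minima R" by blast
      moreover have "\<theta>inf \<omega> = l" unfolding \<theta>inf_def by (rule limI[OF l(1)])
      moreover have "\<theta> k \<omega> \<in> ?B" if "n \<le> k" for k
        using n[of "k - n"] that by (auto simp: stay_def)
      ultimately show "(\<lambda>k. \<theta> k \<omega>) \<longlonglongrightarrow> \<theta>inf \<omega> \<and> \<theta>inf \<omega> \<in> minima R \<and>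
        (\<exists>n. \<forall>k\<ge>n. \<theta> k \<omega> \<in> ?B)" by blast
    qed
    have in_R: "l \<in> ball \<theta>star R"
      if "x \<longlonglongrightarrow> l" "\<forall>k\<ge>n. x k \<in> ?B" for x :: "nat \<Rightarrow> real ^ 'd" and l n
    proof -
      have "l \<in> cball \<theta>star r"
        by (rule Lim_in_closed_set[OF closed_cball _ _ that(1)])
          (use that(2) in \<open>auto simp: eventually_sequentially intro!: exI[of _ n] less_imp_le\<close>)
      then show ?thesis using r R(1) by simp
    qed
    have lim: "AE \<omega> in M. \<omega> \<in> C \<inter> VV \<longrightarrow> (\<lambda>k. \<theta> k \<omega>) \<longlonglongrightarrow> \<theta>inf \<omega> \<and>
        local_minimum f (\<theta>inf \<omega>) \<and> f (\<theta>inf \<omega>) = f \<theta>star"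
      using conv
    proof eventually_elim
      case (elim \<omega>)
      show ?case
      proof
        assume "\<omega> \<in> C \<inter> VV"
        with elim have l: "(\<lambda>k. \<theta> k \<omega>) \<longlonglongrightarrow> \<theta>inf \<omega>" "\<theta>inf \<omega> \<in> minima R" by auto
        then have fl: "f (\<theta>inf \<omega>) = f \<theta>star" and "\<theta>inf \<omega> \<in> U"
          using R by (auto simp: minima_def)
        then have "local_minimum f (\<theta>inf \<omega>)"
          unfolding local_minimum_def using U(1,4) by (intro exI[of _ U]) auto
        with l fl show "(\<lambda>k. \<theta> k \<omega>) \<longlonglongrightarrow> \<theta>inf \<omega> \<and>
          local_minimum f (\<theta>inf \<omega>) \<and> f (\<theta>inf \<omega>) = f \<theta>star" by blast
      qed
    qed
    have rates: "AE \<omega> in M. \<omega> \<in> C \<inter> VV \<longrightarrow>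
        limsup (\<lambda>k. ereal ((?m + \<epsilon>) powi (- int k) * (norm (\<theta> k \<omega> - \<theta>inf \<omega>))\<^sup>2)) = 0 \<and>
        limsup (\<lambda>k. ereal ((?m + \<epsilon>) powi (- int k) * (f (\<theta> k \<omega>) - f (\<theta>inf \<omega>)))) = 0"
      if "0 < \<epsilon>" for \<epsilon>
    proof -
      have limsup0: "limsup (\<lambda>k. ereal (x k)) = 0" if "x \<longlonglongrightarrow> 0" for x
        using that by (intro lim_imp_Limsup) (auto simp: zero_ereal_def)
      have a: "?m < ?m + \<epsilon>" "0 < ?m + \<epsilon>" using that m by auto
      show ?thesis
        using conv AE_rate[OF r(1,2) assms(10) a(1)]
      proof eventually_elim
        case (elim \<omega>)
        show ?case
        proof
          assume "\<omega> \<in> C \<inter> VV"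
          with elim(1) obtain n where l: "(\<lambda>k. \<theta> k \<omega>) \<longlonglongrightarrow> \<theta>inf \<omega>" "\<theta>inf \<omega> \<in> minima R"
            and n: "\<forall>k\<ge>n. \<theta> k \<omega> \<in> ?B" by blast
          have 1: "(\<lambda>k. (?m + \<epsilon>) powi (- int k) * (norm (\<theta> k \<omega> - \<theta>inf \<omega>))\<^sup>2) \<longlonglongrightarrow> 0"
            using elim(2) l n by blast
          have 2: "(\<lambda>k. (?m + \<epsilon>) powi (- int k) * (f (\<theta> k \<omega>) - f (\<theta>inf \<omega>))) \<longlonglongrightarrow> 0"
            by (rule value_rate[OF l in_R[OF l(1) n] a(2) 1])
          show "limsup (\<lambda>k. ereal ((?m + \<epsilon>) powi (- int k) * (norm (\<theta> k \<omega> - \<theta>inf \<omega>))\<^sup>2)) = 0 \<and>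
            limsup (\<lambda>k. ereal ((?m + \<epsilon>) powi (- int k) * (f (\<theta> k \<omega>) - f (\<theta>inf \<omega>)))) = 0"
            using limsup0[OF 1] limsup0[OF 2] by blast
        qed
      qed
    qed
    show "\<exists>V. open V \<and> \<theta>star \<in> V \<and>
      (let VV = (\<Union>k. {\<omega> \<in> space M. \<theta> k \<omega> \<in> V}) in
      \<exists>C \<in> sets M.
        measure M (C \<inter> VV) \<ge> (1 - \<delta>) * measure M VV \<and>
        (\<exists>\<theta>inf \<in> borel_measurable M.
          (AE \<omega> in M. \<omega> \<in> C \<inter> VV \<longrightarrow>
             (\<lambda>k. \<theta> k \<omega>) \<longlonglongrightarrow> \<theta>inf \<omega> \<and>
             local_minimum f (\<theta>inf \<omega>) \<and> f (\<theta>inf \<omega>) = f \<theta>star) \<and>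
          (\<forall>\<epsilon>>0. AE \<omega> in M. \<omega> \<in> C \<inter> VV \<longrightarrow>
             limsup (\<lambda>k. ereal ((rate \<mu> L \<sigma> \<gamma> + \<epsilon>) powi (- int k) * (norm (\<theta> k \<omega> - \<theta>inf \<omega>))\<^sup>2)) = 0 \<and>
             limsup (\<lambda>k. ereal ((rate \<mu> L \<sigma> \<gamma> + \<epsilon>) powi (- int k) * (f (\<theta> k \<omega>) - f (\<theta>inf \<omega>)))) = 0)))"
    proof (rule exI[of _ V], unfold Let_def VV_def[symmetric], intro conjI)
      show "open V" "\<theta>star \<in> V" using r0 by (auto simp: V_def)
      show "\<exists>C \<in> sets M. measure M (C \<inter> VV) \<ge> (1 - \<delta>) * measure M VV \<and>
        (\<exists>\<theta>inf \<in> borel_measurable M.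
          (AE \<omega> in M. \<omega> \<in> C \<inter> VV \<longrightarrow>
             (\<lambda>k. \<theta> k \<omega>) \<longlonglongrightarrow> \<theta>inf \<omega> \<and>
             local_minimum f (\<theta>inf \<omega>) \<and> f (\<theta>inf \<omega>) = f \<theta>star) \<and>
          (\<forall>\<epsilon>>0. AE \<omega> in M. \<omega> \<in> C \<inter> VV \<longrightarrow>
             limsup (\<lambda>k. ereal ((rate \<mu> L \<sigma> \<gamma> + \<epsilon>) powi (- int k) * (norm (\<theta> k \<omega> - \<theta>inf \<omega>))\<^sup>2)) = 0 \<and>
             limsup (\<lambda>k. ereal ((rate \<mu> L \<sigma> \<gamma> + \<epsilon>) powi (- int k) * (f (\<theta> k \<omega>) - f (\<theta>inf \<omega>)))) = 0))"
        by (intro bexI[OF _ C] bexI[OF _ \<theta>inf_meas] conjI meas lim allI impI rates)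
    qed
  qed
qed

end
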